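(* A functor $F\colon\mathcal K\to\mathcal L$ between augmented virtual double categories is part of an equivalence $\mathcal K\simeq\mathcal L$ (that is, an internal equivalence in the 2-category $\mathrm{AugVirtDblCat}$ of augmented virtual double categories, functors and transformations) if and only if it is full, faithful and essentially surjective.
   Context: **Augmented virtual double categories.** An augmented virtual double category $\mathcal K$ consists of: a class of objects; a category $\mathcal K_{\mathrm v}$ with these objects, whose morphisms $f\colon A\to C$ are called vertical; a directed graph $\mathcal K_{\mathrm h}$ with these objects as vertices, whose edges $J\colon A\nrightarrow B$ are called horizontal morphisms; and a class of cells. Each cell $\phi$ has a horizontal source, which is a (possibly empty) path $\underline J=(J_1,\dots,J_n)\colon A_0\nrightarrow A_n$ of horizontal morphisms; a horizontal target, which is a path $\underline K\colon C\nrightarrow D$ of length $|\underline K|\le 1$; a vertical source $f\colon A_0\to C$; and a vertical target $g\colon A_n\to D$. We write $\phi\colon\underline J\Rightarrow\underline K$. The empty path at $A$ is written $(A)$ (so $\underline K=(C)$ forces $C=D$), and $\frown$ denotes concatenation of paths. For each $n\ge 1$, each path of cells $\phi_i\colon\underline J_i\Rightarrow\underline K_i$ ($1\le i\le n$) with vertical source $f_{i-1}$ and vertical target $f_i$, and each cell $\psi\colon\underline K_1\frown\dots\frown\underline K_n\Rightarrow\underline L$ with vertical source $h$ and target $k$, there is a vertical composite $\psi\circ(\phi_1,\dots,\phi_n)\colon\underline J_1\frown\dots\frown\underline J_n\Rightarrow\underline L$ with vertical source $h\circ f_0$ and target $k\circ f_n$. There are horizontal identity cells $\mathrm{id}_J\colon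 J\Rightarrow J$ (with identities as vertical source and target) and vertical identity cells $\mathrm{id}_f\colon (A)\Rightarrow(C)$ for $f\colon A\to C$ (with vertical source and target $f$), with $\mathrm{id}_h\circ(\mathrm{id}_f)=\mathrm{id}_{h\circ f}$; write $\mathrm{id}_A:=\mathrm{id}_{\mathrm{id}_A}$. Axioms, whenever they make sense (for associativity: whenever both sides make sense): $\chi\circ(\psi_1\circ(\phi_{11},\dots,\phi_{1m_1}),\dots,\psi_n\circ(\phi_{n1},\dots,\phi_{nm_n}))=(\chi\circ(\psi_1,\dots,\psi_n))\circ(\phi_{11},\dots,\phi_{nm_n})$; $\mathrm{id}_C\circ(\phi)=\phi$; $\mathrm{id}_K\circ(\phi)=\phi$; $\phi\circ(\mathrm{id}_A)=\phi$; $\phi\circ(\mathrm{id}_{J_1},\dots,\mathrm{id}_{J_n})=\phi$; and $\psi\circ(\phi_1,\dots,\phi_i,\mathrm{id}_{f_i},\phi_{i+1},\dots,\phi_n)=\psi\circ(\phi_1,\dots,\phi_n)$ for $0\le i\le n$. **Functors and transformations.** A functor $F\colon\mathcal K\to\mathcal L$ consists of a functor $F\colon\mathcal K_{\mathrm v}\to\mathcal L_{\mathrm v}$ and assignments sending $J\colon A\nrightarrow B$ to $FJ\colon FA\nrightarrow FB$ and each cell $\phi\colon(J_1,\dots,J_n)\Rightarrow\underline K$ with vertical source $f$ and target $g$ to a cell $F\phi\colon(FJ_1,\dots,FJ_n)\Rightarrow F\underline K$ with vertical source $Ff$ and target $Fg$, strictly preserving vertical composition and identity cells. A transformation $\xi\colon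 F\Rightarrow G$ consists of a natural transformation $\xi\colon F_{\mathrm v}\Rightarrow G_{\mathrm v}$ and, for each $J\colon A\nrightarrow B$, a cell $\xi_J\colon FJ\Rightarrow GJ$ with vertical source $\xi_A$ and target $\xi_B$, such that $G\phi\circ\xi_{\underline J}=\xi_{\underline K}\circ F\phi$ for all $\phi\colon\underline J\Rightarrow\underline K$, where $\xi_{\underline J}=(\xi_{J_1},\dots,\xi_{J_n})$ for non-empty paths and $\xi_{(A)}=\mathrm{id}_{\xi_A}$. With evident compositions these form the 2-category $\mathrm{AugVirtDblCat}$. **Full, faithful, essentially surjective.** $F$ is locally faithful (resp. locally full) if for all $f\colon A_0\to C$, $g\colon A_n\to D$, paths $\underline J\colon A_0\nrightarrow A_n$ and $\underline K\colon C\nrightarrow D$ with $|\underline K|\le1$ in $\mathcal K$, the assignment $\phi\mapsto F\phi$ from cells $\underline J\Rightarrow\underline K$ with vertical source $f$ and target $g$ to cells $F\underline J\Rightarrow F\underline K$ with vertical source $Ff$ and target $Fg$ is injective (resp. surjective). $F$ is faithful (resp. full) if it is locally faithful (resp. locally full) and moreover $F\colon\mathcal K_{\mathrm v}\to\mathcal L_{\mathrm v}$ is faithful (resp. full). $F$ is essentially surjective if one can simultaneously choose: for each object $A\in\mathcal L$, an object $A'\in\mathcal K$ and an isomorphism $\sigma_A\colon FA'\cong A$ in $\mathcal L_{\mathrm v}$; and for each horizontal morphism $J\colon A\nrightarrow B$ of $\mathcal L$, a horizontal morphism $J'\colon A'\nrightarrow B'$ of $\mathcal K$ and an invertible cell $\sigma_J\colon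 FJ'\Rightarrow J$ with vertical source $\sigma_A$ and target $\sigma_B$ (invertible: there is a cell $J\Rightarrow FJ'$ with vertical source $\sigma_A^{-1}$ and target $\sigma_B^{-1}$ that is a two-sided inverse of $\sigma_J$ under vertical composition). *)

theory Defs
  imports Main
begin

section \<open>Augmented virtual double categories\<close>

text \<open>
  A path of horizontal morphisms is stored together with its start vertex, so that the empty
  paths \<open>(A, [])\<close> at different objects are distinct.
\<close>

type_synonym ('o, 'h) hpath = "'o \<times> 'h list"

text \<open>\<open>vcomp K g f\<close> is \<open>g \<circ> f\<close>, and \<open>ccomp K \<psi> [\<phi>\<^sub>1, \<dots>, \<phi>\<^sub>n]\<close> is \<open>\<psi> \<circ> (\<phi>\<^sub>1, \<dots>, \<phi>\<^sub>n)\<close>.\<close>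

record ('o, 'v, 'h, 'c) avdc_data =
  Ob :: "'o set"
  Vert :: "'v set"
  vdom :: "'v \<Rightarrow> 'o"
  vcod :: "'v \<Rightarrow> 'o"
  vid :: "'o \<Rightarrow> 'v"
  vcomp :: "'v \<Rightarrow> 'v \<Rightarrow> 'v"
  Horiz :: "'h set"
  hsrc :: "'h \<Rightarrow> 'o"
  htgt :: "'h \<Rightarrow> 'o"
  Cell :: "'c set"
  csrc :: "'c \<Rightarrow> ('o, 'h) hpath"
  ctgt :: "'c \<Rightarrow> ('o, 'h) hpath"
  cvsrc :: "'c \<Rightarrow> 'v"
  cvtgt :: "'c \<Rightarrow> 'v"
  ccomp :: "'c \<Rightarrow> 'c list \<Rightarrow> 'c"
  hidc :: "'h \<Rightarrow> 'c"
  vidc :: "'v \<Rightarrow> 'c"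

definition vhom :: "('o, 'v, 'h, 'c) avdc_data \<Rightarrow> 'o \<Rightarrow> 'o \<Rightarrow> 'v set" where
  "vhom K A B = {f \<in> Vert K. vdom K f = A \<and> vcod K f = B}"

fun is_walk :: "('o, 'v, 'h, 'c) avdc_data \<Rightarrow> 'o \<Rightarrow> 'h list \<Rightarrow> 'o \<Rightarrow> bool" where
  "is_walk K A [] B \<longleftrightarrow> A \<in> Ob K \<and> A = B"
| "is_walk K A (J # Js) B \<longleftrightarrow> J \<in> Horiz K \<and> hsrc K J = A \<and> is_walk K (htgt K J) Js B"

definition is_hpath :: "('o, 'v, 'h, 'c) avdc_data \<Rightarrow> ('o, 'h) hpath \<Rightarrow> 'o \<Rightarrow> 'o \<Rightarrow> bool" where
  "is_hpath K P A B \<longleftrightarrow> fst P = A \<and> is_walk K (fst P) (snd P) B"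

definition single :: "('o, 'v, 'h, 'c) avdc_data \<Rightarrow> 'h \<Rightarrow> ('o, 'h) hpath" where
  "single K J = (hsrc K J, [J])"

text \<open>Concatenation of a non-empty list of paths, each starting where its predecessor ends.\<close>

definition hconcat :: "('o, 'h) hpath list \<Rightarrow> ('o, 'h) hpath" where
  "hconcat Ps = (fst (hd Ps), concat (map snd Ps))"

definition composable :: "('o, 'v, 'h, 'c) avdc_data \<Rightarrow> 'c \<Rightarrow> 'c list \<Rightarrow> bool" where
  "composable K \<psi> \<phi>s \<longleftrightarrow>
     \<psi> \<in> Cell K \<and> \<phi>s \<noteq> [] \<and> set \<phi>s \<subseteq> Cell K \<and>
     successively (\<lambda>\<phi> \<phi>'. cvtgt K \<phi> = cvsrc K \<phi>') \<phi>s \<and>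
     csrc K \<psi> = hconcat (map (ctgt K) \<phi>s)"

definition cells ::
  "('o, 'v, 'h, 'c) avdc_data \<Rightarrow> ('o, 'h) hpath \<Rightarrow> ('o, 'h) hpath \<Rightarrow> 'v \<Rightarrow> 'v \<Rightarrow> 'c set" where
  "cells K P Q f g =
     {\<phi> \<in> Cell K. csrc K \<phi> = P \<and> ctgt K \<phi> = Q \<and> cvsrc K \<phi> = f \<and> cvtgt K \<phi> = g}"

text \<open>
  In \<open>ccomp_vidc_insert\<close>, composability of the left-hand side forces \<open>f\<close> to be the
  vertical morphism shared by the cells adjacent to \<open>vidc K f\<close>.
\<close>

locale avdc =
  fixes K :: "('o, 'v, 'h, 'c) avdc_data"
  assumes vdom_in: "f \<in> Vert K \<Longrightarrow> vdom K f \<in> Ob K"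
    and vcod_in: "f \<in> Vert K \<Longrightarrow> vcod K f \<in> Ob K"
    and vid_in: "A \<in> Ob K \<Longrightarrow> vid K A \<in> vhom K A A"
    and vcomp_in: "f \<in> vhom K A B \<Longrightarrow> g \<in> vhom K B C \<Longrightarrow> vcomp K g f \<in> vhom K A C"
    and vcomp_vid_left: "f \<in> vhom K A B \<Longrightarrow> vcomp K (vid K B) f = f"
    and vcomp_vid_right: "f \<in> vhom K A B \<Longrightarrow> vcomp K f (vid K A) = f"
    and vcomp_assoc: "f \<in> vhom K A B \<Longrightarrow> g \<in> vhom K B C \<Longrightarrow> h \<in> vhom K C D
          \<Longrightarrow> vcomp K h (vcomp K g f) = vcomp K (vcomp K h g) f"
    and hsrc_in: "J \<in> Horiz K \<Longrightarrow> hsrc K J \<in> Ob K"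
    and htgt_in: "J \<in> Horiz K \<Longrightarrow> htgt K J \<in> Ob K"
    and cvsrc_in: "\<phi> \<in> Cell K \<Longrightarrow> cvsrc K \<phi> \<in> Vert K"
    and cvtgt_in: "\<phi> \<in> Cell K \<Longrightarrow> cvtgt K \<phi> \<in> Vert K"
    and csrc_path: "\<phi> \<in> Cell K
          \<Longrightarrow> is_hpath K (csrc K \<phi>) (vdom K (cvsrc K \<phi>)) (vdom K (cvtgt K \<phi>))"
    and ctgt_path: "\<phi> \<in> Cell K
          \<Longrightarrow> is_hpath K (ctgt K \<phi>) (vcod K (cvsrc K \<phi>)) (vcod K (cvtgt K \<phi>))"
    and ctgt_length: "\<phi> \<in> Cell K \<Longrightarrow> length (snd (ctgt K \<phi>)) \<le> 1"
    and ccomp_in: "composable K \<psi> \<phi>s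
          \<Longrightarrow> ccomp K \<psi> \<phi>s \<in> cells K (hconcat (map (csrc K) \<phi>s)) (ctgt K \<psi>)
                (vcomp K (cvsrc K \<psi>) (cvsrc K (hd \<phi>s)))
                (vcomp K (cvtgt K \<psi>) (cvtgt K (last \<phi>s)))"
    and hidc_in: "J \<in> Horiz K
          \<Longrightarrow> hidc K J \<in> cells K (single K J) (single K J) (vid K (hsrc K J)) (vid K (htgt K J))"
    and vidc_in: "f \<in> vhom K A C \<Longrightarrow> vidc K f \<in> cells K (A, []) (C, []) f f"
    and vidc_vcomp: "f \<in> vhom K A B \<Longrightarrow> h \<in> vhom K B C
          \<Longrightarrow> ccomp K (vidc K h) [vidc K f] = vidc K (vcomp K h f)"
    and ccomp_assoc: "\<lbrakk>length \<phi>ss = length \<psi>s; list_all2 (composable K) \<psi>s \<phi>ss;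
            composable K \<chi> (map2 (ccomp K) \<psi>s \<phi>ss);
            composable K \<chi> \<psi>s; composable K (ccomp K \<chi> \<psi>s) (concat \<phi>ss)\<rbrakk>
          \<Longrightarrow> ccomp K \<chi> (map2 (ccomp K) \<psi>s \<phi>ss) = ccomp K (ccomp K \<chi> \<psi>s) (concat \<phi>ss)"
    and vidc_ccomp: "\<phi> \<in> Cell K \<Longrightarrow> ctgt K \<phi> = (C, [])
          \<Longrightarrow> ccomp K (vidc K (vid K C)) [\<phi>] = \<phi>"
    and hidc_ccomp: "\<phi> \<in> Cell K \<Longrightarrow> ctgt K \<phi> = single K J
          \<Longrightarrow> ccomp K (hidc K J) [\<phi>] = \<phi>"
    and ccomp_vidc: "\<phi> \<in> Cell K \<Longrightarrow> csrc K \<phi> = (A, [])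
          \<Longrightarrow> ccomp K \<phi> [vidc K (vid K A)] = \<phi>"
    and ccomp_hidc: "\<phi> \<in> Cell K \<Longrightarrow> csrc K \<phi> = (A, Js) \<Longrightarrow> Js \<noteq> []
          \<Longrightarrow> ccomp K \<phi> (map (hidc K) Js) = \<phi>"
    and ccomp_vidc_insert: "\<lbrakk>f \<in> Vert K; \<phi>s @ \<phi>s' \<noteq> []; composable K \<psi> (\<phi>s @ vidc K f # \<phi>s')\<rbrakk>
          \<Longrightarrow> ccomp K \<psi> (\<phi>s @ vidc K f # \<phi>s') = ccomp K \<psi> (\<phi>s @ \<phi>s')"


section \<open>Functors\<close>

record ('o, 'v, 'h, 'c, 'p, 'w, 'k, 'd) avdc_map =
  fob :: "'o \<Rightarrow> 'p"
  fvert :: "'v \<Rightarrow> 'w"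
  fhoriz :: "'h \<Rightarrow> 'k"
  fcell :: "'c \<Rightarrow> 'd"

definition fpath ::
  "('o, 'v, 'h, 'c, 'p, 'w, 'k, 'd) avdc_map \<Rightarrow> ('o, 'h) hpath \<Rightarrow> ('p, 'k) hpath" where
  "fpath F P = (fob F (fst P), map (fhoriz F) (snd P))"

locale avdc_functor = K: avdc K + L: avdc L
  for K :: "('o, 'v, 'h, 'c) avdc_data" and L :: "('p, 'w, 'k, 'd) avdc_data" +
  fixes F :: "('o, 'v, 'h, 'c, 'p, 'w, 'k, 'd) avdc_map"
  assumes fob_in: "A \<in> Ob K \<Longrightarrow> fob F A \<in> Ob L"
    and fvert_in: "f \<in> vhom K A B \<Longrightarrow> fvert F f \<in> vhom L (fob F A) (fob F B)"
    and fvert_vid: "A \<in> Ob K \<Longrightarrow> fvert F (vid K A) = vid L (fob F A)"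
    and fvert_vcomp: "f \<in> vhom K A B \<Longrightarrow> g \<in> vhom K B C
          \<Longrightarrow> fvert F (vcomp K g f) = vcomp L (fvert F g) (fvert F f)"
    and fhoriz_in: "J \<in> Horiz K \<Longrightarrow> fhoriz F J \<in> Horiz L"
    and fhoriz_hsrc: "J \<in> Horiz K \<Longrightarrow> hsrc L (fhoriz F J) = fob F (hsrc K J)"
    and fhoriz_htgt: "J \<in> Horiz K \<Longrightarrow> htgt L (fhoriz F J) = fob F (htgt K J)"
    and fcell_in: "\<phi> \<in> cells K P Q f g
          \<Longrightarrow> fcell F \<phi> \<in> cells L (fpath F P) (fpath F Q) (fvert F f) (fvert F g)"
    and fcell_ccomp: "composable K \<psi> \<phi>s
          \<Longrightarrow> fcell F (ccomp K \<psi> \<phi>s) = ccomp L (fcell F \<psi>) (map (fcell F) \<phi>s)"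
    and fcell_hidc: "J \<in> Horiz K \<Longrightarrow> fcell F (hidc K J) = hidc L (fhoriz F J)"
    and fcell_vidc: "f \<in> Vert K \<Longrightarrow> fcell F (vidc K f) = vidc L (fvert F f)"

definition id_functor :: "('o, 'v, 'h, 'c, 'o, 'v, 'h, 'c) avdc_map" where
  "id_functor = \<lparr>fob = (\<lambda>A. A), fvert = (\<lambda>f. f), fhoriz = (\<lambda>J. J), fcell = (\<lambda>\<phi>. \<phi>)\<rparr>"

definition functor_comp ::
  "('p, 'w, 'k, 'd, 'q, 'x, 'l, 'e) avdc_map \<Rightarrow> ('o, 'v, 'h, 'c, 'p, 'w, 'k, 'd) avdc_map
     \<Rightarrow> ('o, 'v, 'h, 'c, 'q, 'x, 'l, 'e) avdc_map" where
  "functor_comp G F =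
     \<lparr>fob = fob G \<circ> fob F, fvert = fvert G \<circ> fvert F,
      fhoriz = fhoriz G \<circ> fhoriz F, fcell = fcell G \<circ> fcell F\<rparr>"


section \<open>Transformations\<close>

record ('o, 'h, 'w, 'd) avdc_trans_data =
  tob :: "'o \<Rightarrow> 'w"
  thoriz :: "'h \<Rightarrow> 'd"

definition tpath ::
  "('p, 'w, 'k, 'd) avdc_data \<Rightarrow> ('o, 'h, 'w, 'd) avdc_trans_data \<Rightarrow> ('o, 'h) hpath \<Rightarrow> 'd list" where
  "tpath L \<xi> P =
     (if snd P = [] then [vidc L (tob \<xi> (fst P))] else map (thoriz \<xi>) (snd P))"

text \<open>
  In \<open>naturality\<close>, \<open>tpath L \<xi> (ctgt K \<phi>)\<close> has exactly one element, since horizontal targets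
  have length at most one.
\<close>

locale avdc_trans = F: avdc_functor K L F + G: avdc_functor K L G
  for K :: "('o, 'v, 'h, 'c) avdc_data" and L :: "('p, 'w, 'k, 'd) avdc_data"
    and F G :: "('o, 'v, 'h, 'c, 'p, 'w, 'k, 'd) avdc_map" +
  fixes \<xi> :: "('o, 'h, 'w, 'd) avdc_trans_data"
  assumes tob_in: "A \<in> Ob K \<Longrightarrow> tob \<xi> A \<in> vhom L (fob F A) (fob G A)"
    and tob_natural: "f \<in> vhom K A C
          \<Longrightarrow> vcomp L (fvert G f) (tob \<xi> A) = vcomp L (tob \<xi> C) (fvert F f)"
    and thoriz_in: "J \<in> Horiz K
          \<Longrightarrow> thoriz \<xi> J \<in> cells L (single L (fhoriz F J)) (single L (fhoriz G J))
                (tob \<xi> (hsrc K J)) (tob \<xi> (htgt K J))"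
    and naturality: "\<phi> \<in> Cell K
          \<Longrightarrow> ccomp L (fcell G \<phi>) (tpath L \<xi> (csrc K \<phi>))
              = ccomp L (hd (tpath L \<xi> (ctgt K \<phi>))) [fcell F \<phi>]"

definition id_trans ::
  "('p, 'w, 'k, 'd) avdc_data \<Rightarrow> ('o, 'v, 'h, 'c, 'p, 'w, 'k, 'd) avdc_map
     \<Rightarrow> ('o, 'h, 'w, 'd) avdc_trans_data" where
  "id_trans L F = \<lparr>tob = (\<lambda>A. vid L (fob F A)), thoriz = (\<lambda>J. hidc L (fhoriz F J))\<rparr>"

definition trans_comp ::
  "('p, 'w, 'k, 'd) avdc_data \<Rightarrow> ('o, 'h, 'w, 'd) avdc_trans_data
     \<Rightarrow> ('o, 'h, 'w, 'd) avdc_trans_data \<Rightarrow> ('o, 'h, 'w, 'd) avdc_trans_data" where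
  "trans_comp L \<zeta> \<xi> =
     \<lparr>tob = (\<lambda>A. vcomp L (tob \<zeta> A) (tob \<xi> A)),
      thoriz = (\<lambda>J. ccomp L (thoriz \<zeta> J) [thoriz \<xi> J])\<rparr>"

text \<open>
  Components outside the carriers of the source are junk, so equality of transformations is
  equality of components on the carriers.
\<close>

definition trans_eq ::
  "('o, 'v, 'h, 'c) avdc_data \<Rightarrow> ('o, 'h, 'w, 'd) avdc_trans_data
     \<Rightarrow> ('o, 'h, 'w, 'd) avdc_trans_data \<Rightarrow> bool" where
  "trans_eq K \<xi> \<zeta> \<longleftrightarrow>
     (\<forall>A\<in>Ob K. tob \<xi> A = tob \<zeta> A) \<and> (\<forall>J\<in>Horiz K. thoriz \<xi> J = thoriz \<zeta> J)"

definition invertible_trans ::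
  "('o, 'v, 'h, 'c) avdc_data \<Rightarrow> ('p, 'w, 'k, 'd) avdc_data
     \<Rightarrow> ('o, 'v, 'h, 'c, 'p, 'w, 'k, 'd) avdc_map \<Rightarrow> ('o, 'v, 'h, 'c, 'p, 'w, 'k, 'd) avdc_map
     \<Rightarrow> ('o, 'h, 'w, 'd) avdc_trans_data \<Rightarrow> bool" where
  "invertible_trans K L F G \<xi> \<longleftrightarrow>
     avdc_trans K L F G \<xi> \<and>
     (\<exists>\<zeta>. avdc_trans K L G F \<zeta> \<and>
          trans_eq K (trans_comp L \<zeta> \<xi>) (id_trans L F) \<and>
          trans_eq K (trans_comp L \<xi> \<zeta>) (id_trans L G))"

text \<open>
  Internal equivalence in the 2-category of augmented virtual double categories: only the
  composition of 1-cells and the vertical composition of 2-cells enter.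
\<close>

definition avdc_equivalence ::
  "('o, 'v, 'h, 'c) avdc_data \<Rightarrow> ('p, 'w, 'k, 'd) avdc_data
     \<Rightarrow> ('o, 'v, 'h, 'c, 'p, 'w, 'k, 'd) avdc_map \<Rightarrow> bool" where
  "avdc_equivalence K L F \<longleftrightarrow>
     avdc_functor K L F \<and>
     (\<exists>G \<eta> \<epsilon>. avdc_functor L K G \<and>
        invertible_trans K K id_functor (functor_comp G F) \<eta> \<and>
        invertible_trans L L (functor_comp F G) id_functor \<epsilon>)"


section \<open>Full, faithful and essentially surjective functors\<close>

definition boundary ::
  "('o, 'v, 'h, 'c) avdc_data \<Rightarrow> ('o, 'h) hpath \<Rightarrow> ('o, 'h) hpath \<Rightarrow> 'v \<Rightarrow> 'v \<Rightarrow> bool" where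
  "boundary K P Q f g \<longleftrightarrow>
     f \<in> Vert K \<and> g \<in> Vert K \<and>
     is_hpath K P (vdom K f) (vdom K g) \<and> is_hpath K Q (vcod K f) (vcod K g) \<and>
     length (snd Q) \<le> 1"

definition locally_faithful ::
  "('o, 'v, 'h, 'c) avdc_data \<Rightarrow> ('p, 'w, 'k, 'd) avdc_data
     \<Rightarrow> ('o, 'v, 'h, 'c, 'p, 'w, 'k, 'd) avdc_map \<Rightarrow> bool" where
  "locally_faithful K L F \<longleftrightarrow>
     (\<forall>P Q f g. boundary K P Q f g \<longrightarrow> inj_on (fcell F) (cells K P Q f g))"

definition locally_full ::
  "('o, 'v, 'h, 'c) avdc_data \<Rightarrow> ('p, 'w, 'k, 'd) avdc_data
     \<Rightarrow> ('o, 'v, 'h, 'c, 'p, 'w, 'k, 'd) avdc_map \<Rightarrow> bool" where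
  "locally_full K L F \<longleftrightarrow>
     (\<forall>P Q f g. boundary K P Q f g \<longrightarrow>
        fcell F ` cells K P Q f g
        = cells L (fpath F P) (fpath F Q) (fvert F f) (fvert F g))"

definition faithful ::
  "('o, 'v, 'h, 'c) avdc_data \<Rightarrow> ('p, 'w, 'k, 'd) avdc_data
     \<Rightarrow> ('o, 'v, 'h, 'c, 'p, 'w, 'k, 'd) avdc_map \<Rightarrow> bool" where
  "faithful K L F \<longleftrightarrow>
     locally_faithful K L F \<and>
     (\<forall>A\<in>Ob K. \<forall>B\<in>Ob K. inj_on (fvert F) (vhom K A B))"

definition full ::
  "('o, 'v, 'h, 'c) avdc_data \<Rightarrow> ('p, 'w, 'k, 'd) avdc_data
     \<Rightarrow> ('o, 'v, 'h, 'c, 'p, 'w, 'k, 'd) avdc_map \<Rightarrow> bool" where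
  "full K L F \<longleftrightarrow>
     locally_full K L F \<and>
     (\<forall>A\<in>Ob K. \<forall>B\<in>Ob K. fvert F ` vhom K A B = vhom L (fob F A) (fob F B))"

definition vinverse :: "('o, 'v, 'h, 'c) avdc_data \<Rightarrow> 'v \<Rightarrow> 'v \<Rightarrow> bool" where
  "vinverse K f g \<longleftrightarrow>
     f \<in> Vert K \<and> g \<in> vhom K (vcod K f) (vdom K f) \<and>
     vcomp K g f = vid K (vdom K f) \<and> vcomp K f g = vid K (vcod K f)"

definition invertible_cell :: "('o, 'v, 'h, 'c) avdc_data \<Rightarrow> 'h \<Rightarrow> 'h \<Rightarrow> 'c \<Rightarrow> bool" where
  "invertible_cell K J J' \<phi> \<longleftrightarrow>
     \<phi> \<in> Cell K \<and> csrc K \<phi> = single K J \<and> ctgt K \<phi> = single K J' \<and>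
     (\<exists>f g. vinverse K (cvsrc K \<phi>) f \<and> vinverse K (cvtgt K \<phi>) g \<and>
        (\<exists>\<psi> \<in> cells K (single K J') (single K J) f g.
           ccomp K \<psi> [\<phi>] = hidc K J \<and> ccomp K \<phi> [\<psi>] = hidc K J'))"

definition essentially_surjective ::
  "('o, 'v, 'h, 'c) avdc_data \<Rightarrow> ('p, 'w, 'k, 'd) avdc_data
     \<Rightarrow> ('o, 'v, 'h, 'c, 'p, 'w, 'k, 'd) avdc_map \<Rightarrow> bool" where
  "essentially_surjective K L F \<longleftrightarrow>
     (\<exists>(ob' :: 'p \<Rightarrow> 'o) (\<sigma>\<^sub>o :: 'p \<Rightarrow> 'w) (hor' :: 'k \<Rightarrow> 'h) (\<sigma>\<^sub>h :: 'k \<Rightarrow> 'd).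
        (\<forall>A\<in>Ob L. ob' A \<in> Ob K \<and> \<sigma>\<^sub>o A \<in> vhom L (fob F (ob' A)) A \<and> (\<exists>g. vinverse L (\<sigma>\<^sub>o A) g)) \<and>
        (\<forall>J\<in>Horiz L. hor' J \<in> Horiz K \<and>
           hsrc K (hor' J) = ob' (hsrc L J) \<and> htgt K (hor' J) = ob' (htgt L J) \<and>
           invertible_cell L (fhoriz F (hor' J)) J (\<sigma>\<^sub>h J) \<and>
           cvsrc L (\<sigma>\<^sub>h J) = \<sigma>\<^sub>o (hsrc L J) \<and> cvtgt L (\<sigma>\<^sub>h J) = \<sigma>\<^sub>o (htgt L J)))"

end

theory Submission
  imports Defs
begin

text \<open>
  An invertible transformation \<open>\<xi>: F \<Rightarrow> G\<close> recovers \<open>F \<phi>\<close> from \<open>G \<phi>\<close> as the conjugate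
  \<open>\<xi>\<^sup>-\<^sup>1 \<circ> (G \<phi> \<circ> \<xi>)\<close>, and conjugation is injective. If \<open>F\<close> has a pseudo-inverse \<open>G\<close>, then conjugation
  with \<open>id \<cong> GF\<close> makes \<open>F\<close> faithful, and \<open>G\<close> is faithful for the same reason; a cell \<open>\<chi>\<close> between
  images of \<open>F\<close> is then \<open>F\<close> of the conjugate of \<open>G \<chi>\<close>, because both have the same image under \<open>G\<close>.

  Conversely, choose \<open>\<sigma>: F A' \<cong> A\<close> and \<open>F J' \<cong> J\<close>, and let \<open>G\<close> send \<open>A\<close>, \<open>J\<close> to \<open>A'\<close>, \<open>J'\<close> and each
  vertical morphism or cell to the unique \<open>F\<close>-preimage of its conjugate by \<open>\<sigma>\<close>. All functor axioms for
  \<open>G\<close> follow from uniqueness, \<open>\<sigma>\<close> is an invertible transformation \<open>FG \<cong> id\<close>, and reflecting the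
  whiskering \<open>\<sigma>F: FGF \<cong> F\<close> along \<open>F\<close> gives \<open>GF \<cong> id\<close>.
\<close>

section \<open>Paths of cells and associativity\<close>

text \<open>The sources and the targets of a row of adjacent cells may concatenate to paths of any
  length, so a row is not itself a cell. It is given the same boundary data as a cell in
  \<open>cells\<close>, which lets typing facts be chained in the same way.\<close>

definition cell_path ::
  "('o, 'v, 'h, 'c) avdc_data \<Rightarrow> 'c list \<Rightarrow> ('o, 'h) hpath \<Rightarrow> ('o, 'h) hpath \<Rightarrow> 'v \<Rightarrow> 'v \<Rightarrow> bool" where
  "cell_path K \<phi>s P Q f g \<longleftrightarrow>
     \<phi>s \<noteq> [] \<and> set \<phi>s \<subseteq> Cell K \<and>
     successively (\<lambda>\<phi> \<phi>'. cvtgt K \<phi> = cvsrc K \<phi>') \<phi>s \<and>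
     hconcat (map (csrc K) \<phi>s) = P \<and> hconcat (map (ctgt K) \<phi>s) = Q \<and>
     cvsrc K (hd \<phi>s) = f \<and> cvtgt K (last \<phi>s) = g"

text \<open>
  Components along a concatenation of paths agree with the concatenated components only up to
  vertical identity cells (one for each empty path), so they are compared through the composites
  they give rise to in any surrounding context.
\<close>

definition absorbs :: "('o, 'v, 'h, 'c) avdc_data \<Rightarrow> 'c list \<Rightarrow> 'c list \<Rightarrow> bool" where
  "absorbs K xs ys \<longleftrightarrow>
     (\<forall>\<chi> us vs. composable K \<chi> (us @ xs @ vs) \<longrightarrow>
        composable K \<chi> (us @ ys @ vs) \<and> ccomp K \<chi> (us @ xs @ vs) = ccomp K \<chi> (us @ ys @ vs))"

lemma cells_iff:
  "\<phi> \<in> cells K P Q f g \<longleftrightarrow>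
     \<phi> \<in> Cell K \<and> csrc K \<phi> = P \<and> ctgt K \<phi> = Q \<and> cvsrc K \<phi> = f \<and> cvtgt K \<phi> = g"
  by (auto simp: cells_def)

lemma vhom_iff: "f \<in> vhom K A B \<longleftrightarrow> f \<in> Vert K \<and> vdom K f = A \<and> vcod K f = B"
  by (auto simp: vhom_def)

lemma hconcat_single [simp]: "hconcat [P] = P"
  by (simp add: hconcat_def)

lemma cell_path_single: "\<phi> \<in> cells K P Q f g \<Longrightarrow> cell_path K [\<phi>] P Q f g"
  by (auto simp: cell_path_def cells_iff)

lemma cell_path_append:
  assumes "cell_path K xs P Q f g" "cell_path K ys P' Q' g h"
  shows "cell_path K (xs @ ys) (fst P, snd P @ snd P') (fst Q, snd Q @ snd Q') f h"
  using assms by (auto simp: cell_path_def hconcat_def successively_append_iff)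

lemma composable_cells:
  assumes "composable K \<psi> \<phi>s"
  shows "\<psi> \<in> Cell K" "\<And>\<phi>. \<phi> \<in> set \<phi>s \<Longrightarrow> \<phi> \<in> Cell K" "\<phi>s \<noteq> []"
  using assms by (auto simp: composable_def)

lemma composable_compose:
  assumes "cell_path K \<phi>s P Q f g" "\<psi> \<in> cells K Q R h k"
  shows "composable K \<psi> \<phi>s"
  using assms by (auto simp: composable_def cell_path_def cells_iff)

lemma absorbs_refl: "absorbs K xs xs"
  by (simp add: absorbs_def)

lemma absorbs_trans: "absorbs K xs ys \<Longrightarrow> absorbs K ys zs \<Longrightarrow> absorbs K xs zs"
  by (simp add: absorbs_def)

lemma absorbs_append_left:
  assumes "absorbs K xs ys"
  shows "absorbs K (us @ xs) (us @ ys)"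
  unfolding absorbs_def
proof (intro allI impI)
  fix \<chi> pre vs
  assume "composable K \<chi> (pre @ (us @ xs) @ vs)"
  then show "composable K \<chi> (pre @ (us @ ys) @ vs) \<and>
      ccomp K \<chi> (pre @ (us @ xs) @ vs) = ccomp K \<chi> (pre @ (us @ ys) @ vs)"
    using assms[unfolded absorbs_def, rule_format, of \<chi> "pre @ us" vs] by simp
qed

lemma absorbs_ccomp: "absorbs K xs ys \<Longrightarrow> composable K \<chi> xs \<Longrightarrow> ccomp K \<chi> xs = ccomp K \<chi> ys"
  unfolding absorbs_def by (metis append.left_neutral append.right_neutral)

section \<open>Boundaries of composites, interchange, and removal of vertical identities\<close>

context avdc
begin

lemma walk_objects:
  assumes "is_walk K A Js B"
  shows "A \<in> Ob K" "B \<in> Ob K"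
  using assms by (induction Js arbitrary: A) (auto simp: hsrc_in)

lemma hpath_objects:
  assumes "is_hpath K P A B"
  shows "A \<in> Ob K" "B \<in> Ob K" "fst P = A"
  using assms walk_objects unfolding is_hpath_def by metis+

lemma ccomp_cell_path:
  assumes "cell_path K \<phi>s P Q f g" "\<psi> \<in> cells K Q R h k"
  shows "ccomp K \<psi> \<phi>s \<in> cells K P R (vcomp K h f) (vcomp K k g)"
  using ccomp_in[OF composable_compose[OF assms]] assms
  by (auto simp: cell_path_def cells_iff)

lemma ccomp_single:
  assumes "\<phi> \<in> cells K P Q f g" "\<psi> \<in> cells K Q R h k"
  shows "composable K \<psi> [\<phi>]" "ccomp K \<psi> [\<phi>] \<in> cells K P R (vcomp K h f) (vcomp K k g)"
  using composable_compose[OF cell_path_single[OF assms(1)] assms(2)]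
    ccomp_cell_path[OF cell_path_single[OF assms(1)] assms(2)] by auto

lemma cells_boundary:
  assumes "\<phi> \<in> cells K P Q f g"
  shows "boundary K P Q f g"
  using assms cvsrc_in cvtgt_in csrc_path ctgt_path ctgt_length
  by (auto simp: boundary_def cells_iff)

lemma cell_objects:
  assumes "\<phi> \<in> Cell K"
  shows "cvsrc K \<phi> \<in> vhom K (fst (csrc K \<phi>)) (fst (ctgt K \<phi>))"
  using cvsrc_in[OF assms] csrc_path[OF assms] ctgt_path[OF assms]
  by (auto simp: is_hpath_def vhom_iff)

text \<open>An empty target starts and ends at the same vertex, and it ends at the codomain of the
  shared vertical morphism, which is where the next target starts.\<close>

lemma ctgt_junction:
  assumes "\<phi> \<in> Cell K" "\<phi>' \<in> Cell K" "cvtgt K \<phi> = cvsrc K \<phi>'" "snd (ctgt K \<phi>) = []"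
  shows "fst (ctgt K \<phi>) = fst (ctgt K \<phi>')"
  using ctgt_path[OF assms(1)] ctgt_path[OF assms(2)] assms(3,4) by (auto simp: is_hpath_def)

lemma csrc_junction:
  assumes "\<phi> \<in> Cell K" "\<phi>' \<in> Cell K" "cvtgt K \<phi> = cvsrc K \<phi>'" "snd (csrc K \<phi>) = []"
  shows "fst (csrc K \<phi>) = fst (csrc K \<phi>')"
  using csrc_path[OF assms(1)] csrc_path[OF assms(2)] assms(3,4) by (auto simp: is_hpath_def)

text \<open>Supplies two of the composability premises of \<open>ccomp_assoc\<close>. Composing each
  \<open>\<psi> x\<close> with a row below keeps its target, so \<open>\<chi>\<close> still fits on
  top; the sources of the cells \<open>\<psi> x\<close> are the glued targets of the rows, so the
  flattened rows still fit below. Indexing both levels by one list of labels avoids zipped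
  lists.\<close>

lemma composable_assoc:
  assumes \<chi>: "composable K \<chi> (map \<psi> xs)"
    and \<psi>: "\<And>x. x \<in> set xs \<Longrightarrow> composable K (\<psi> x) (\<phi>s x)"
    and adj: "successively (\<lambda>x y. cvtgt K (last (\<phi>s x)) = cvsrc K (hd (\<phi>s y))) xs"
  shows "composable K \<chi> (map (\<lambda>x. ccomp K (\<psi> x) (\<phi>s x)) xs)"
    and "composable K (ccomp K \<chi> (map \<psi> xs)) (concat (map \<phi>s xs))"
proof -
  have ne: "xs \<noteq> []" and succ: "successively (\<lambda>x y. cvtgt K (\<psi> x) = cvsrc K (\<psi> y)) xs"
    using \<chi> by (auto simp: composable_def successively_map)
  have cc: "ccomp K (\<psi> x) (\<phi>s x) \<in> cells K (hconcat (map (csrc K) (\<phi>s x))) (ctgt K (\<psi> x))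
      (vcomp K (cvsrc K (\<psi> x)) (cvsrc K (hd (\<phi>s x))))
      (vcomp K (cvtgt K (\<psi> x)) (cvtgt K (last (\<phi>s x))))" if "x \<in> set xs" for x
    using ccomp_in \<psi> that by blast
  \<comment> \<open>The vertical boundaries of the composites are themselves composites:
    \<open>succ\<close> matches their left factors and \<open>adj\<close> their right
    factors.\<close>
  have "successively (\<lambda>x y. cvtgt K (ccomp K (\<psi> x) (\<phi>s x)) = cvsrc K (ccomp K (\<psi> y) (\<phi>s y))) xs"
    using succ adj cc by (induction xs rule: induct_list012) (auto simp: cells_iff)
  moreover have tg: "map (\<lambda>x. ctgt K (ccomp K (\<psi> x) (\<phi>s x))) xs = map (\<lambda>x. ctgt K (\<psi> x)) xs"
    using cc by (auto simp: cells_iff)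
  ultimately show "composable K \<chi> (map (\<lambda>x. ccomp K (\<psi> x) (\<phi>s x)) xs)"
    using \<chi> cc ne by (auto simp: composable_def successively_map cells_iff comp_def simp del: map_eq_conv)
  have \<phi>ne: "\<phi>s x \<noteq> []" if "x \<in> set xs" for x
    using \<psi> that by (auto simp: composable_def)
  have hdc: "hd (concat (map \<phi>s xs)) = hd (\<phi>s (hd xs))"
    using ne \<phi>ne by (cases xs) (auto)
  have cne: "concat (map \<phi>s xs) \<noteq> []"
    using ne \<phi>ne by (cases xs) auto
  have sc: "successively (\<lambda>\<phi> \<phi>'. cvtgt K \<phi> = cvsrc K \<phi>') (concat (map \<phi>s xs))"
    using adj \<psi>
  proof (induction xs rule: induct_list012)
    case (3 x y zs)
    have "\<phi>s y \<noteq> []" using "3.prems"(2)[of y] by (auto simp: composable_def)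
    then show ?case using 3
      by (auto simp: successively_append_iff composable_def)
  qed (auto simp: composable_def)
  have src: "csrc K (\<psi> x) = hconcat (map (ctgt K) (\<phi>s x))" if "x \<in> set xs" for x
    using \<psi> that by (auto simp: composable_def)
  \<comment> \<open>The lists of horizontal morphisms agree by flattening row by row. The start
    vertex is compared separately, since \<open>hconcat\<close> reads it from the first path
    alone.\<close>
  have "map snd (map (csrc K) (map \<psi> xs)) = map (\<lambda>x. concat (map snd (map (ctgt K) (\<phi>s x)))) xs"
    using src by (auto simp: hconcat_def)
  then have "concat (map snd (map (csrc K) (map \<psi> xs))) =
      concat (map snd (map (ctgt K) (concat (map \<phi>s xs))))"
    by (simp only:) (induction xs, auto)
  moreover have "fst (hd (map (csrc K) (map \<psi> xs))) = fst (hd (map (ctgt K) (concat (map \<phi>s xs))))"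
    using ne cne hdc src[of "hd xs"] \<phi>ne[of "hd xs"]
    by (simp add: hd_map hconcat_def)
  ultimately have "hconcat (map (csrc K) (map \<psi> xs)) = hconcat (map (ctgt K) (concat (map \<phi>s xs)))"
    by (simp only: hconcat_def)
  then show "composable K (ccomp K \<chi> (map \<psi> xs)) (concat (map \<phi>s xs))"
    using ccomp_in[OF \<chi>] cne sc \<psi>
    by (auto simp: composable_def cells_iff)
qed

lemma ccomp_assoc_map:
  assumes "composable K \<chi> (map \<psi> xs)"
    and "\<And>x. x \<in> set xs \<Longrightarrow> composable K (\<psi> x) (\<phi>s x)"
    and "successively (\<lambda>x y. cvtgt K (last (\<phi>s x)) = cvsrc K (hd (\<phi>s y))) xs"
  shows "ccomp K \<chi> (map (\<lambda>x. ccomp K (\<psi> x) (\<phi>s x)) xs) =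
    ccomp K (ccomp K \<chi> (map \<psi> xs)) (concat (map \<phi>s xs))"
proof -
  have eq: "map2 (ccomp K) (map \<psi> xs) (map \<phi>s xs) = map (\<lambda>x. ccomp K (\<psi> x) (\<phi>s x)) xs"
    by (induction xs) auto
  have "list_all2 (composable K) (map \<psi> xs) (map \<phi>s xs)"
    using assms(2) by (auto simp: list_all2_map1 list_all2_map2 list_all2_same)
  then show ?thesis
    using ccomp_assoc[of "map \<phi>s xs" "map \<psi> xs" \<chi>] composable_assoc[OF assms] assms(1)
    by (simp add: eq)
qed

lemma ccomp_assoc_single:
  assumes "composable K \<chi> [\<psi>]" "composable K \<psi> \<phi>s"
  shows "ccomp K \<chi> [ccomp K \<psi> \<phi>s] = ccomp K (ccomp K \<chi> [\<psi>]) \<phi>s"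
  using ccomp_assoc_map[of \<chi> "\<lambda>_. \<psi>" "[()]" "\<lambda>_. \<phi>s"] assms by simp

lemma vidc_cells: "f \<in> Vert K \<Longrightarrow> vidc K f \<in> cells K (vdom K f, []) (vcod K f, []) f f"
  by (simp add: vidc_in vhom_iff)

text \<open>A vertical identity cell has equal vertical source and target, so its neighbours become
  adjacent when it is removed, and its empty target adds nothing to the concatenation. The row left
  over must be non-empty, since \<open>composable\<close> demands this.\<close>

lemma composable_remove_vidc:
  assumes "f \<in> Vert K" "us @ vs \<noteq> []" "composable K \<chi> (us @ vidc K f # vs)"
  shows "composable K \<chi> (us @ vs)"
proof (cases us)
  \<comment> \<open>The identity cell comes first here, so the start vertex of the concatenated
    targets is afterwards read from the next cell. It is the same vertex because that cell has
    vertical source \<open>f\<close>.\<close>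
  case Nil
  then obtain \<phi> vs' where vs: "vs = \<phi> # vs'" using assms(2) by (cases vs) auto
  have \<phi>: "\<phi> \<in> Cell K" "cvsrc K \<phi> = f"
    using assms(3) Nil vs vidc_cells[OF assms(1)] by (auto simp: composable_def cells_iff)
  then have "fst (ctgt K \<phi>) = vcod K f" using cell_objects[of \<phi>] by (simp add: vhom_iff)
  then show ?thesis
    using assms(3) Nil vs vidc_cells[OF assms(1)]
    by (auto simp: composable_def cells_iff hconcat_def)
next
  case (Cons \<phi> us')
  then show ?thesis
    using assms(3)[unfolded Cons] vidc_cells[OF assms(1)]
    by (cases vs) (auto simp: composable_def cells_iff hconcat_def successively_append_iff
        successively_Cons last_ConsR simp flip: append_Cons)
qed

lemma absorbs_vidc_left: "f \<in> Vert K \<Longrightarrow> ys \<noteq> [] \<Longrightarrow> absorbs K (vidc K f # ys) ys"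
  unfolding absorbs_def
  using composable_remove_vidc[of f] ccomp_vidc_insert[of f] by (metis append_Cons append_is_Nil_conv)

lemma absorbs_vidc_right:
  assumes "f \<in> Vert K" "xs \<noteq> []"
  shows "absorbs K (xs @ [vidc K f]) xs"
  unfolding absorbs_def
proof (intro allI impI)
  fix \<chi> us vs
  assume "composable K \<chi> (us @ (xs @ [vidc K f]) @ vs)"
  then show "composable K \<chi> (us @ xs @ vs) \<and>
      ccomp K \<chi> (us @ (xs @ [vidc K f]) @ vs) = ccomp K \<chi> (us @ xs @ vs)"
    using composable_remove_vidc[of f "us @ xs" vs] ccomp_vidc_insert[of f "us @ xs" vs] assms by simp
qed

end

section \<open>Families of components\<close>

text \<open>Typing of paths and of components refers only to objects and horizontal morphisms. The
  fields \<open>fvert\<close> and \<open>fcell\<close> stay unconstrained, so a map can be used here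
  before its action on vertical morphisms and cells has been chosen.\<close>

locale avdc_graph_map = K: avdc K + L: avdc L
  for K :: "('o, 'v, 'h, 'c) avdc_data" and L :: "('p, 'w, 'k, 'd) avdc_data" +
  fixes F :: "('o, 'v, 'h, 'c, 'p, 'w, 'k, 'd) avdc_map"
  assumes ob_in: "A \<in> Ob K \<Longrightarrow> fob F A \<in> Ob L"
    and horiz_in: "J \<in> Horiz K \<Longrightarrow> fhoriz F J \<in> Horiz L"
    and horiz_src: "J \<in> Horiz K \<Longrightarrow> hsrc L (fhoriz F J) = fob F (hsrc K J)"
    and horiz_tgt: "J \<in> Horiz K \<Longrightarrow> htgt L (fhoriz F J) = fob F (htgt K J)"
begin

lemma walk_map: "is_walk K A Js B \<Longrightarrow> is_walk L (fob F A) (map (fhoriz F) Js) (fob F B)"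
  by (induction Js arbitrary: A) (auto simp: ob_in horiz_in horiz_src horiz_tgt)

lemma hpath_map: "is_hpath K P A B \<Longrightarrow> is_hpath L (fpath F P) (fob F A) (fob F B)"
  by (auto simp: is_hpath_def fpath_def walk_map)

lemma fpath_single: "J \<in> Horiz K \<Longrightarrow> fpath F (single K J) = single L (fhoriz F J)"
  by (simp add: fpath_def single_def horiz_src)

end

lemma fpath_hconcat: "Ps \<noteq> [] \<Longrightarrow> fpath F (hconcat Ps) = hconcat (map (fpath F) Ps)"
  by (cases Ps) (auto simp: fpath_def hconcat_def map_concat comp_def)

sublocale avdc_functor \<subseteq> graph: avdc_graph_map K L F
  by unfold_locales (auto simp: fob_in fhoriz_in fhoriz_hsrc fhoriz_htgt)

text \<open>
  The data of a transformation without naturality. Vertical morphisms and cells are left aside so that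
  such a family can be used before the action of a functor on them has been constructed.
\<close>

locale avdc_family = F: avdc_graph_map K L F + G: avdc_graph_map K L G
  for K :: "('o, 'v, 'h, 'c) avdc_data" and L :: "('p, 'w, 'k, 'd) avdc_data"
    and F G :: "('o, 'v, 'h, 'c, 'p, 'w, 'k, 'd) avdc_map" +
  fixes \<xi> :: "('o, 'h, 'w, 'd) avdc_trans_data"
  assumes ob_comp: "A \<in> Ob K \<Longrightarrow> tob \<xi> A \<in> vhom L (fob F A) (fob G A)"
    and horiz_comp: "J \<in> Horiz K
          \<Longrightarrow> thoriz \<xi> J \<in> cells L (single L (fhoriz F J)) (single L (fhoriz G J))
                (tob \<xi> (hsrc K J)) (tob \<xi> (htgt K J))"
begin

lemma cell_path_tpath:
  assumes "is_hpath K P A B"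
  shows "cell_path L (tpath L \<xi> P) (fpath F P) (fpath G P) (tob \<xi> A) (tob \<xi> B)"
proof -
  have "cell_path L (tpath L \<xi> (A, Js)) (fpath F (A, Js)) (fpath G (A, Js)) (tob \<xi> A) (tob \<xi> B)"
    if "is_walk K A Js B" for Js
    using that
  proof (induction Js arbitrary: A)
    case Nil
    then show ?case
      using F.L.vidc_in[OF ob_comp[of A]]
      by (auto simp: tpath_def fpath_def intro: cell_path_single)
  next
    case (Cons J Js)
    have J: "cell_path L [thoriz \<xi> J] (fpath F (A, [J])) (fpath G (A, [J]))
        (tob \<xi> A) (tob \<xi> (htgt K J))"
      using Cons.prems cell_path_single[OF horiz_comp[of J]]
      by (auto simp: fpath_def single_def F.horiz_src G.horiz_src)
    show ?case
    \<comment> \<open>For a path of length one, appending the components of the empty rest would add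
      a vertical identity cell that \<open>tpath\<close> does not contain.\<close>
    proof (cases "Js = []")
      case True
      then show ?thesis using J Cons.prems by (simp add: tpath_def)
    next
      case False
      then show ?thesis
        using cell_path_append[OF J Cons.IH[of "htgt K J"]] Cons.prems
        by (simp add: tpath_def fpath_def)
    qed
  qed
  then show ?thesis using assms unfolding is_hpath_def by (metis prod.collapse)
qed

lemma tpath_singleton: "length (snd Q) \<le> 1 \<Longrightarrow> tpath L \<xi> Q = [hd (tpath L \<xi> Q)]"
  by (cases "snd Q") (auto simp: tpath_def)

lemma hd_tpath:
  assumes "is_hpath K Q A B" "length (snd Q) \<le> 1"
  shows "hd (tpath L \<xi> Q) \<in> cells L (fpath F Q) (fpath G Q) (tob \<xi> A) (tob \<xi> B)"
  using cell_path_tpath[OF assms(1)] tpath_singleton[OF assms(2)]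
  by (metis cell_path_def cells_iff hconcat_single last.simps list.map list.set_intros(1) list.sel(1) subsetD)

text \<open>Each empty path in \<open>Ps\<close> contributes a vertical identity cell, whereas the
  concatenation has one only if it is empty altogether; the surplus ones are absorbed by a
  neighbour. The junction hypothesis ensures that dropping a leading empty path does not change the
  start vertex.\<close>

lemma absorbs_tpath:
  assumes "Ps \<noteq> []" "\<And>P. P \<in> set Ps \<Longrightarrow> fst P \<in> Ob K"
    and "successively (\<lambda>P Q. snd P = [] \<longrightarrow> fst P = fst Q) Ps"
  shows "absorbs L (concat (map (tpath L \<xi>) Ps)) (tpath L \<xi> (hconcat Ps))"
  using assms
proof (induction Ps rule: list_nonempty_induct)
  case (single P)
  then show ?case by (simp add: absorbs_refl)
next
  case (cons P Ps)
  define Q where "Q = hconcat Ps"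
  have Q: "fst Q = fst (hd Ps)" "hd Ps \<in> set Ps" using cons.hyps by (auto simp: Q_def hconcat_def)
  have P: "snd P = [] \<Longrightarrow> fst P = fst Q"
    using cons.prems(2) cons.hyps Q by (cases Ps) auto
  have ob: "fst P \<in> Ob K" "fst Q \<in> Ob K" using cons.prems(1) Q by auto
  then have vert: "tob \<xi> (fst P) \<in> Vert L" "tob \<xi> (fst Q) \<in> Vert L"
    using ob_comp by (auto simp: vhom_iff)
  have eq: "hconcat (P # Ps) = (fst P, snd P @ snd Q)"
    by (simp add: Q_def hconcat_def)
  have "absorbs L (tpath L \<xi> P @ tpath L \<xi> Q) (tpath L \<xi> (hconcat (P # Ps)))"
  \<comment> \<open>An empty \<open>P\<close> leaves an identity cell in front, an empty
    \<open>Q\<close> one at the end. If both are empty, the first case applies and one identity cell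
    survives.\<close>
  proof (cases "snd P = []")
    case True
    have "tpath L \<xi> (hconcat (P # Ps)) = tpath L \<xi> Q"
      using True P by (simp add: eq tpath_def)
    moreover have "tpath L \<xi> P = [vidc L (tob \<xi> (fst P))]" "tpath L \<xi> Q \<noteq> []"
      using True by (auto simp: tpath_def)
    ultimately show ?thesis using F.L.absorbs_vidc_left[OF vert(1)] by simp
  next
    case False
    show ?thesis
    proof (cases "snd Q = []")
      case True
      then show ?thesis
        using False F.L.absorbs_vidc_right[OF vert(2)] by (simp add: eq tpath_def)
    next
      case False
      then show ?thesis using \<open>snd P \<noteq> []\<close> by (simp add: eq tpath_def absorbs_refl)
    qed
  qed
  moreover have "absorbs L (concat (map (tpath L \<xi>) (P # Ps))) (tpath L \<xi> P @ tpath L \<xi> Q)"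
    using absorbs_append_left[OF cons.IH] cons.prems cons.hyps by (cases Ps) (auto simp: Q_def)
  ultimately show ?case using absorbs_trans by blast
qed

end

text \<open>Provides the premises of \<open>absorbs_tpath\<close> for the targets of a composable
  row; \<open>csrcs_junctions\<close> does so for the sources.\<close>

lemma (in avdc) ctgts_junctions:
  assumes "composable K \<psi> \<phi>s"
  shows "map (ctgt K) \<phi>s \<noteq> []" "\<And>P. P \<in> set (map (ctgt K) \<phi>s) \<Longrightarrow> fst P \<in> Ob K"
    "successively (\<lambda>P Q. snd P = [] \<longrightarrow> fst P = fst Q) (map (ctgt K) \<phi>s)"
proof -
  show "map (ctgt K) \<phi>s \<noteq> []" "\<And>P. P \<in> set (map (ctgt K) \<phi>s) \<Longrightarrow> fst P \<in> Ob K"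
    using assms hpath_objects[OF ctgt_path] by (auto simp: composable_def)
  have "set \<phi>s \<subseteq> Cell K" "successively (\<lambda>\<phi> \<phi>'. cvtgt K \<phi> = cvsrc K \<phi>') \<phi>s"
    using assms by (auto simp: composable_def)
  then show "successively (\<lambda>P Q. snd P = [] \<longrightarrow> fst P = fst Q) (map (ctgt K) \<phi>s)"
    by (induction \<phi>s rule: induct_list012) (auto simp: ctgt_junction)
qed

lemma (in avdc) csrcs_junctions:
  assumes "composable K \<psi> \<phi>s"
  shows "map (csrc K) \<phi>s \<noteq> []" "\<And>P. P \<in> set (map (csrc K) \<phi>s) \<Longrightarrow> fst P \<in> Ob K"
    "successively (\<lambda>P Q. snd P = [] \<longrightarrow> fst P = fst Q) (map (csrc K) \<phi>s)"
proof -
  show "map (csrc K) \<phi>s \<noteq> []" "\<And>P. P \<in> set (map (csrc K) \<phi>s) \<Longrightarrow> fst P \<in> Ob K"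
    using assms hpath_objects[OF csrc_path] by (auto simp: composable_def)
  have "set \<phi>s \<subseteq> Cell K" "successively (\<lambda>\<phi> \<phi>'. cvtgt K \<phi> = cvsrc K \<phi>') \<phi>s"
    using assms by (auto simp: composable_def)
  then show "successively (\<lambda>P Q. snd P = [] \<longrightarrow> fst P = fst Q) (map (csrc K) \<phi>s)"
    by (induction \<phi>s rule: induct_list012) (auto simp: csrc_junction)
qed

section \<open>Conjugation by a componentwise invertible family\<close>

text \<open>The components are mutually inverse, but naturality is not part of the data. Conjugation
  is thus available for constructing the functor with respect to which the family then becomes
  natural.\<close>

locale avdc_iso_family = K: avdc K + L: avdc L + fwd: avdc_family K L F G \<xi> + bwd: avdc_family K L G F \<zeta>
  for K :: "('o, 'v, 'h, 'c) avdc_data" and L :: "('p, 'w, 'k, 'd) avdc_data"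
    and F G :: "('o, 'v, 'h, 'c, 'p, 'w, 'k, 'd) avdc_map"
    and \<xi> \<zeta> :: "('o, 'h, 'w, 'd) avdc_trans_data" +
  assumes left_inv: "trans_eq K (trans_comp L \<zeta> \<xi>) (id_trans L F)"
    and right_inv: "trans_eq K (trans_comp L \<xi> \<zeta>) (id_trans L G)"
begin

lemma swap: "avdc_iso_family K L G F \<zeta> \<xi>"
  using left_inv right_inv by unfold_locales

lemma left_inv_comp:
  "A \<in> Ob K \<Longrightarrow> vcomp L (tob \<zeta> A) (tob \<xi> A) = vid L (fob F A)"
  "J \<in> Horiz K \<Longrightarrow> ccomp L (thoriz \<zeta> J) [thoriz \<xi> J] = hidc L (fhoriz F J)"
  using left_inv by (auto simp: trans_eq_def trans_comp_def id_trans_def)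

text \<open>Interchange pairs the two rows column by column, and each column is a horizontal
  identity by the inverse law. Along an empty path the component is a vertical identity cell, so
  there the inverse law for vertical morphisms is used instead.\<close>

lemma cancel_source:
  assumes \<chi>: "\<chi> \<in> cells L (fpath F P) Q f g" and P: "is_hpath K P A B"
  shows "ccomp L (ccomp L \<chi> (tpath L \<zeta> P)) (tpath L \<xi> P) = \<chi>"
proof (cases "snd P = []")
  case True
  then have A: "A \<in> Ob K" and P': "P = (A, [])" using P by (cases P; auto simp: is_hpath_def)+
  note v = fwd.ob_comp[OF A] bwd.ob_comp[OF A]
  note \<xi>v = L.vidc_in[OF v(1)] and \<zeta>v = L.vidc_in[OF v(2)]
  have \<chi>': "\<chi> \<in> cells L (fob F A, []) Q f g" using \<chi> P' by (simp add: fpath_def)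
  have "ccomp L (ccomp L \<chi> [vidc L (tob \<zeta> A)]) [vidc L (tob \<xi> A)] =
      ccomp L \<chi> [ccomp L (vidc L (tob \<zeta> A)) [vidc L (tob \<xi> A)]]"
    using L.ccomp_assoc_single L.ccomp_single(1)[OF \<zeta>v \<chi>'] L.ccomp_single(1)[OF \<xi>v \<zeta>v] by simp
  also have "\<dots> = \<chi>"
    using L.vidc_vcomp[OF v] left_inv_comp(1)[OF A] L.ccomp_vidc \<chi>' by (auto simp: cells_iff)
  finally show ?thesis using P' by (simp add: tpath_def)
next
  case False
  obtain Js where P': "P = (A, Js)" "Js \<noteq> []" "is_walk K A Js B"
    using P False by (cases P) (auto simp: is_hpath_def)
  have t: "tpath L \<xi> P = map (thoriz \<xi>) Js" "tpath L \<zeta> P = map (thoriz \<zeta>) Js"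
    using P' by (auto simp: tpath_def)
  have J: "J \<in> Horiz K" if "J \<in> set Js" for J
    using P'(3) that by (induction Js arbitrary: A) auto
  have "composable L \<chi> (map (thoriz \<zeta>) Js)"
    using composable_compose[OF bwd.cell_path_tpath[OF P] \<chi>] t by simp
  moreover have "composable L (thoriz \<zeta> J) [thoriz \<xi> J]" if "J \<in> set Js" for J
    using L.ccomp_single(1)[OF fwd.horiz_comp bwd.horiz_comp] J[OF that] by blast
  moreover have "successively (\<lambda>J J'. cvtgt L (last [thoriz \<xi> J]) = cvsrc L (hd [thoriz \<xi> J'])) Js"
    using fwd.cell_path_tpath[OF P] t by (simp add: cell_path_def successively_map)
  ultimately have "ccomp L (ccomp L \<chi> (map (thoriz \<zeta>) Js)) (concat (map (\<lambda>J. [thoriz \<xi> J]) Js)) =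
      ccomp L \<chi> (map (\<lambda>J. ccomp L (thoriz \<zeta> J) [thoriz \<xi> J]) Js)"
    by (rule L.ccomp_assoc_map[symmetric])
  also have "map (\<lambda>J. ccomp L (thoriz \<zeta> J) [thoriz \<xi> J]) Js = map (hidc L) (map (fhoriz F) Js)"
    using left_inv_comp(2) J by simp
  also have "ccomp L \<chi> \<dots> = \<chi>"
    using \<chi> P' by (intro L.ccomp_hidc) (auto simp: cells_iff fpath_def)
  finally show ?thesis by (simp add: t)
qed

text \<open>Components at a path of length at most one are single cells. After reassociation they
  compose to an identity cell, vertical or horizontal according to whether \<open>Q\<close> is
  empty.\<close>

lemma cancel_target:
  assumes \<phi>: "\<phi> \<in> cells L P (fpath F Q) f g" and Q: "is_hpath K Q A B" "length (snd Q) \<le> 1"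
  shows "ccomp L (hd (tpath L \<zeta> Q)) [ccomp L (hd (tpath L \<xi> Q)) [\<phi>]] = \<phi>"
proof -
  note \<xi>Q = fwd.hd_tpath[OF Q] and \<zeta>Q = bwd.hd_tpath[OF Q]
  have "ccomp L (hd (tpath L \<zeta> Q)) [ccomp L (hd (tpath L \<xi> Q)) [\<phi>]] =
      ccomp L (ccomp L (hd (tpath L \<zeta> Q)) [hd (tpath L \<xi> Q)]) [\<phi>]"
    by (rule L.ccomp_assoc_single[OF L.ccomp_single(1)[OF \<xi>Q \<zeta>Q] L.ccomp_single(1)[OF \<phi> \<xi>Q]])
  also have "\<dots> = \<phi>"
  proof (cases "snd Q")
    case Nil
    then have A: "A \<in> Ob K" "Q = (A, [])" using Q by (cases Q; auto simp: is_hpath_def)+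
    then show ?thesis
      using L.vidc_vcomp[OF fwd.ob_comp bwd.ob_comp, of A] left_inv_comp(1) L.vidc_ccomp \<phi>
      by (simp add: tpath_def cells_iff fpath_def)
  next
    case (Cons J Js)
    then have J: "J \<in> Horiz K" "Q = single K J"
      using Q by (cases Q; auto simp: is_hpath_def single_def)+
    then show ?thesis
      using left_inv_comp(2) L.hidc_ccomp \<phi> fwd.F.fpath_single
      by (auto simp: tpath_def cells_iff single_def)
  qed
  finally show ?thesis .
qed

text \<open>The paths are arguments because they cannot be read off from the cell: its boundary
  shows only \<open>fpath G P\<close> and \<open>fpath G Q\<close>, and \<open>fpath G\<close> need
  not be injective.\<close>

definition conj :: "('o, 'h) hpath \<Rightarrow> ('o, 'h) hpath \<Rightarrow> 'd \<Rightarrow> 'd" where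
  "conj P Q \<chi> = ccomp L (hd (tpath L \<zeta> Q)) [ccomp L \<chi> (tpath L \<xi> P)]"

lemma conj_steps:
  assumes \<chi>: "\<chi> \<in> cells L (fpath G P) (fpath G Q) f g"
    and P: "is_hpath K P A B" and Q: "is_hpath K Q C D" "length (snd Q) \<le> 1"
  shows "ccomp L \<chi> (tpath L \<xi> P) \<in> cells L (fpath F P) (fpath G Q) (vcomp L f (tob \<xi> A)) (vcomp L g (tob \<xi> B))"
    and "conj P Q \<chi> \<in> cells L (fpath F P) (fpath F Q)
       (vcomp L (tob \<zeta> C) (vcomp L f (tob \<xi> A))) (vcomp L (tob \<zeta> D) (vcomp L g (tob \<xi> B)))"
proof -
  show 1: "ccomp L \<chi> (tpath L \<xi> P) \<in> cells L (fpath F P) (fpath G Q) (vcomp L f (tob \<xi> A)) (vcomp L g (tob \<xi> B))"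
    by (rule L.ccomp_cell_path[OF fwd.cell_path_tpath[OF P] \<chi>])
  show "conj P Q \<chi> \<in> cells L (fpath F P) (fpath F Q)
       (vcomp L (tob \<zeta> C) (vcomp L f (tob \<xi> A))) (vcomp L (tob \<zeta> D) (vcomp L g (tob \<xi> B)))"
    unfolding conj_def by (rule L.ccomp_single(2)[OF 1 bwd.hd_tpath[OF Q]])
qed

text \<open>Composing with the invertible component at \<open>Q\<close>, in one direction or the
  other, turns either equation into its counterpart. Naturality at a cell is thereby an explicit
  formula for one of the two images in terms of the other.\<close>

lemma conj_iff:
  assumes \<chi>: "\<chi> \<in> cells L (fpath G P) (fpath G Q) f g"
    and \<phi>: "\<phi> \<in> cells L (fpath F P) (fpath F Q) f' g'"
    and P: "is_hpath K P A B" and Q: "is_hpath K Q C D" "length (snd Q) \<le> 1"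
  shows "\<phi> = conj P Q \<chi> \<longleftrightarrow> ccomp L \<chi> (tpath L \<xi> P) = ccomp L (hd (tpath L \<xi> Q)) [\<phi>]"
  using avdc_iso_family.cancel_target[OF swap conj_steps(1)[OF \<chi> P Q] Q] cancel_target[OF \<phi> Q]
  unfolding conj_def by metis

text \<open>The component at the target is cancelled first, then the row at the source. The vertical
  boundaries of the two cells are allowed to differ a priori.\<close>

lemma conj_inj:
  assumes \<chi>: "\<chi> \<in> cells L (fpath G P) (fpath G Q) f g" "\<chi>' \<in> cells L (fpath G P) (fpath G Q) f' g'"
    and P: "is_hpath K P A B" and Q: "is_hpath K Q C D" "length (snd Q) \<le> 1"
    and eq: "conj P Q \<chi> = conj P Q \<chi>'"
  shows "\<chi> = \<chi>'"
proof -
  note canc = avdc_iso_family.cancel_target[OF swap _ Q] avdc_iso_family.cancel_source[OF swap _ P]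
  have "ccomp L \<chi> (tpath L \<xi> P) = ccomp L \<chi>' (tpath L \<xi> P)"
    using canc(1)[OF conj_steps(1)[OF \<chi>(1) P Q]] canc(1)[OF conj_steps(1)[OF \<chi>(2) P Q]] eq
    unfolding conj_def by metis
  then show ?thesis using canc(2)[OF \<chi>(1)] canc(2)[OF \<chi>(2)] by metis
qed

definition vconj :: "'o \<Rightarrow> 'o \<Rightarrow> 'w \<Rightarrow> 'w" where
  "vconj A B f = vcomp L (tob \<zeta> B) (vcomp L f (tob \<xi> A))"

lemma vconj_in:
  assumes "f \<in> vhom L (fob G A) (fob G B)" "A \<in> Ob K" "B \<in> Ob K"
  shows "vconj A B f \<in> vhom L (fob F A) (fob F B)"
  unfolding vconj_def
  using L.vcomp_in[OF L.vcomp_in[OF fwd.ob_comp assms(1)] bwd.ob_comp] assms(2,3) by blast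

lemma vcancel_target:
  assumes "f \<in> vhom L A (fob F B)" "B \<in> Ob K"
  shows "vcomp L (tob \<zeta> B) (vcomp L (tob \<xi> B) f) = f"
  using L.vcomp_assoc[OF assms(1) fwd.ob_comp bwd.ob_comp] left_inv_comp(1) L.vcomp_vid_left
    assms by metis

lemma vcancel_source:
  assumes "f \<in> vhom L (fob F A) B" "A \<in> Ob K"
  shows "vcomp L (vcomp L f (tob \<zeta> A)) (tob \<xi> A) = f"
  using L.vcomp_assoc[OF fwd.ob_comp bwd.ob_comp assms(1)] left_inv_comp(1) L.vcomp_vid_right
    assms by metis

lemma vconj_iff:
  assumes f: "f \<in> vhom L (fob G A) (fob G B)" and e: "e \<in> vhom L (fob F A) (fob F B)"
    and ob: "A \<in> Ob K" "B \<in> Ob K"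
  shows "e = vconj A B f \<longleftrightarrow> vcomp L f (tob \<xi> A) = vcomp L (tob \<xi> B) e"
  using avdc_iso_family.vcancel_target[OF swap L.vcomp_in[OF fwd.ob_comp f] ob(2)]
    vcancel_target[OF e ob(2)] ob
  unfolding vconj_def by metis

lemma vconj_inj:
  assumes f: "f \<in> vhom L (fob G A) (fob G B)" "f' \<in> vhom L (fob G A) (fob G B)"
    and ob: "A \<in> Ob K" "B \<in> Ob K" and eq: "vconj A B f = vconj A B f'"
  shows "f = f'"
proof -
  note canc = avdc_iso_family.vcancel_target[OF swap _ ob(2)] avdc_iso_family.vcancel_source[OF swap _ ob(1)]
  have "vcomp L f (tob \<xi> A) = vcomp L f' (tob \<xi> A)"
    using canc(1)[OF L.vcomp_in[OF fwd.ob_comp f(1)]] canc(1)[OF L.vcomp_in[OF fwd.ob_comp f(2)]] eq ob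
    unfolding vconj_def by metis
  then show ?thesis using canc(2)[OF f(1)] canc(2)[OF f(2)] by metis
qed

lemma conj_in:
  assumes "\<chi> \<in> cells L (fpath G P) (fpath G Q) f g"
    and "is_hpath K P A B" and "is_hpath K Q C D" "length (snd Q) \<le> 1"
  shows "conj P Q \<chi> \<in> cells L (fpath F P) (fpath F Q) (vconj A C f) (vconj B D g)"
  using conj_steps(2)[OF assms] by (simp add: vconj_def)

end

sublocale avdc_trans \<subseteq> family: avdc_family K L F G \<xi>
  by unfold_locales (auto simp: tob_in thoriz_in)

lemma invertible_transE:
  assumes "invertible_trans K L F G \<xi>"
  obtains \<zeta> where "avdc_trans K L F G \<xi>" "avdc_trans K L G F \<zeta>" "avdc_iso_family K L F G \<xi> \<zeta>"
proof -
  obtain \<zeta> where \<zeta>: "avdc_trans K L F G \<xi>" "avdc_trans K L G F \<zeta>"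
      "trans_eq K (trans_comp L \<zeta> \<xi>) (id_trans L F)" "trans_eq K (trans_comp L \<xi> \<zeta>) (id_trans L G)"
    using assms by (auto simp: invertible_trans_def)
  interpret f: avdc_trans K L F G \<xi> by (rule \<zeta>(1))
  interpret b: avdc_trans K L G F \<zeta> by (rule \<zeta>(2))
  have "avdc_iso_family K L F G \<xi> \<zeta>"
    using \<zeta>(3,4) by unfold_locales
  then show ?thesis using \<zeta> that by blast
qed

section \<open>Composition, whiskering and reflection\<close>

lemma avdc_functor_id:
  assumes "avdc K"
  shows "avdc_functor K K id_functor"
proof -
  interpret avdc K by fact
  show ?thesis by unfold_locales (auto simp: id_functor_def fpath_def)
qed

lemma fpath_id [simp]: "fpath id_functor P = P"
  by (simp add: fpath_def id_functor_def)

lemma fpath_functor_comp: "fpath (functor_comp G F) P = fpath G (fpath F P)"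
  by (simp add: fpath_def functor_comp_def)

lemma functor_comp_sel [simp]:
  "fob (functor_comp G F) A = fob G (fob F A)"
  "fvert (functor_comp G F) f = fvert G (fvert F f)"
  "fhoriz (functor_comp G F) J = fhoriz G (fhoriz F J)"
  "fcell (functor_comp G F) \<phi> = fcell G (fcell F \<phi>)"
  by (simp_all add: functor_comp_def)

lemma id_functor_sel [simp]:
  "fob id_functor A = A" "fvert id_functor f = f" "fhoriz id_functor J = J" "fcell id_functor \<phi> = \<phi>"
  by (simp_all add: id_functor_def)

lemma functor_comp_id_left [simp]: "functor_comp id_functor F = F"
  by (simp add: functor_comp_def id_functor_def comp_def)

lemma functor_comp_id_right [simp]: "functor_comp F id_functor = F"
  by (simp add: functor_comp_def id_functor_def comp_def)

lemma functor_comp_assoc: "functor_comp (functor_comp H G) F = functor_comp H (functor_comp G F)"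
  by (simp add: functor_comp_def comp_assoc)

text \<open>Assumes only that boundaries are respected, because it is also applied to the lifted map
  in order to prove that this map preserves composition.\<close>

lemma composable_map_cells:
  assumes F: "\<And>\<phi> P Q f g. \<phi> \<in> cells K P Q f g
      \<Longrightarrow> fcell F \<phi> \<in> cells L (fpath F P) (fpath F Q) (fvert F f) (fvert F g)"
    and comp: "composable K \<psi> \<phi>s"
  shows "composable L (fcell F \<psi>) (map (fcell F) \<phi>s)"
proof -
  have c: "fcell F \<phi> \<in> Cell L \<and> csrc L (fcell F \<phi>) = fpath F (csrc K \<phi>) \<and>
      ctgt L (fcell F \<phi>) = fpath F (ctgt K \<phi>) \<and> cvsrc L (fcell F \<phi>) = fvert F (cvsrc K \<phi>) \<and>
      cvtgt L (fcell F \<phi>) = fvert F (cvtgt K \<phi>)" if "\<phi> \<in> Cell K" for \<phi>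
    using F[of \<phi> "csrc K \<phi>"] that by (auto simp: cells_iff)
  have \<phi>s: "\<phi>s \<noteq> []" "set \<phi>s \<subseteq> Cell K" "successively (\<lambda>\<phi> \<phi>'. cvtgt K \<phi> = cvsrc K \<phi>') \<phi>s"
    using comp by (auto simp: composable_def)
  then have "successively (\<lambda>\<phi> \<phi>'. cvtgt L (fcell F \<phi>) = cvsrc L (fcell F \<phi>')) \<phi>s"
    using c by (induction \<phi>s rule: induct_list012) auto
  moreover have "map (ctgt L) (map (fcell F) \<phi>s) = map (fpath F) (map (ctgt K) \<phi>s)"
    using \<phi>s c by auto
  moreover have "csrc L (fcell F \<psi>) = hconcat (map (fpath F) (map (ctgt K) \<phi>s))"
    using comp c[of \<psi>] fpath_hconcat[of "map (ctgt K) \<phi>s" F] by (simp add: composable_def)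
  ultimately show ?thesis
    using \<phi>s c comp unfolding composable_def by (auto simp only: successively_map set_map)
qed

lemma avdc_functor_comp:
  assumes "avdc_functor K L F" "avdc_functor L M G"
  shows "avdc_functor K M (functor_comp G F)"
proof -
  interpret F: avdc_functor K L F by fact
  interpret G: avdc_functor L M G by fact
  show ?thesis
  proof unfold_locales
    fix \<psi> \<phi>s assume c: "composable K \<psi> \<phi>s"
    show "fcell (functor_comp G F) (ccomp K \<psi> \<phi>s) =
        ccomp M (fcell (functor_comp G F) \<psi>) (map (fcell (functor_comp G F)) \<phi>s)"
      using F.fcell_ccomp[OF c] G.fcell_ccomp[OF composable_map_cells[OF F.fcell_in c]]
      by (simp add: functor_comp_def)
  next
    fix f assume "f \<in> Vert K"
    then have "fvert F f \<in> Vert L" using F.fvert_in[of f] by (simp add: vhom_iff)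
    then show "fcell (functor_comp G F) (vidc K f) = vidc M (fvert (functor_comp G F) f)"
      using F.fcell_vidc G.fcell_vidc \<open>f \<in> Vert K\<close> by simp
  qed (auto simp: F.fob_in G.fob_in F.fvert_in G.fvert_in F.fvert_vid G.fvert_vid
      F.fhoriz_in G.fhoriz_in F.fhoriz_hsrc G.fhoriz_hsrc F.fhoriz_htgt G.fhoriz_htgt
      F.fcell_in G.fcell_in F.fcell_hidc G.fcell_hidc fpath_functor_comp F.fvert_vcomp
      G.fvert_vcomp[OF F.fvert_in F.fvert_in])
qed

lemma (in avdc) cell_dest:
  assumes "\<phi> \<in> Cell K"
  obtains A B C D where
    "\<phi> \<in> cells K (csrc K \<phi>) (ctgt K \<phi>) (cvsrc K \<phi>) (cvtgt K \<phi>)"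
    "is_hpath K (csrc K \<phi>) A B" "is_hpath K (ctgt K \<phi>) C D" "length (snd (ctgt K \<phi>)) \<le> 1"
    "cvsrc K \<phi> \<in> vhom K A C" "cvtgt K \<phi> \<in> vhom K B D"
  using assms csrc_path ctgt_path ctgt_length cvsrc_in cvtgt_in
  by (metis (no_types, lifting) cells_iff vhom_iff)

lemma (in avdc_trans) cell_types:
  assumes "\<phi> \<in> Cell K"
  obtains A B C D where
    "is_hpath K (csrc K \<phi>) A B" "is_hpath K (ctgt K \<phi>) C D" "length (snd (ctgt K \<phi>)) \<le> 1"
    "cvsrc K \<phi> \<in> vhom K A C" "cvtgt K \<phi> \<in> vhom K B D"
    "fcell F \<phi> \<in> cells L (fpath F (csrc K \<phi>)) (fpath F (ctgt K \<phi>)) (fvert F (cvsrc K \<phi>)) (fvert F (cvtgt K \<phi>))"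
    "fcell G \<phi> \<in> cells L (fpath G (csrc K \<phi>)) (fpath G (ctgt K \<phi>)) (fvert G (cvsrc K \<phi>)) (fvert G (cvtgt K \<phi>))"
  using F.K.cell_dest[OF assms] F.fcell_in G.fcell_in by metis

context avdc_iso_family
begin

lemma conj_natural:
  assumes "avdc_trans K L F G \<xi>" and "\<phi> \<in> Cell K"
  shows "fcell F \<phi> = conj (csrc K \<phi>) (ctgt K \<phi>) (fcell G \<phi>)"
proof -
  interpret avdc_trans K L F G \<xi> by fact
  show ?thesis
    using cell_types[OF assms(2)] conj_iff naturality[OF assms(2)] by metis
qed

lemma vconj_natural:
  assumes "avdc_trans K L F G \<xi>" and "f \<in> vhom K A B"
  shows "fvert F f = vconj A B (fvert G f)"
proof -
  interpret avdc_trans K L F G \<xi> by fact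
  have "A \<in> Ob K" "B \<in> Ob K" using assms(2) K.vdom_in K.vcod_in by (auto simp: vhom_iff)
  then show ?thesis
    using vconj_iff[OF G.fvert_in F.fvert_in] tob_natural assms(2) by metis
qed

text \<open>Naturality of \<open>\<xi>\<close> expresses \<open>F \<phi>\<close> as
  \<open>G \<phi>\<close> between a component of \<open>\<zeta>\<close> and a row of
  \<open>\<xi>\<close>. Composing with \<open>\<zeta>\<close> along the source cancels that row and
  leaves naturality of \<open>\<zeta>\<close>.\<close>

lemma inverse_trans:
  assumes "avdc_trans K L F G \<xi>"
  shows "avdc_trans K L G F \<zeta>"
proof -
  interpret \<xi>: avdc_trans K L F G \<xi> by fact
  interpret swap: avdc_iso_family K L G F \<zeta> \<xi> by (rule swap)
  show ?thesis
  proof unfold_locales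
    fix f A C assume f: "f \<in> vhom K A C"
    then have ob: "A \<in> Ob K" "C \<in> Ob K" using K.vdom_in K.vcod_in by (auto simp: vhom_iff)
    have "fvert F f = vcomp L (tob \<zeta> C) (vcomp L (fvert G f) (tob \<xi> A))"
      using vconj_natural[OF assms f] by (simp add: vconj_def)
    also have "\<dots> = vcomp L (vcomp L (tob \<zeta> C) (fvert G f)) (tob \<xi> A)"
      using L.vcomp_assoc \<xi>.tob_in bwd.ob_comp \<xi>.G.fvert_in f ob by blast
    finally show "vcomp L (fvert F f) (tob \<zeta> A) = vcomp L (tob \<zeta> C) (fvert G f)"
      using swap.vcancel_source[OF L.vcomp_in[OF \<xi>.G.fvert_in[OF f] bwd.ob_comp[OF ob(2)]] ob(1)] by simp
  next
    fix \<phi> assume \<phi>: "\<phi> \<in> Cell K"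
    let ?P = "csrc K \<phi>" and ?Q = "ctgt K \<phi>"
    from \<phi> obtain A B C D where P: "is_hpath K ?P A B" and Q: "is_hpath K ?Q C D" "length (snd ?Q) \<le> 1"
      and F: "fcell F \<phi> \<in> cells L (fpath F ?P) (fpath F ?Q) (fvert F (cvsrc K \<phi>)) (fvert F (cvtgt K \<phi>))"
      and G: "fcell G \<phi> \<in> cells L (fpath G ?P) (fpath G ?Q) (fvert G (cvsrc K \<phi>)) (fvert G (cvtgt K \<phi>))"
      using \<xi>.cell_types by metis
    note \<zeta>Q = bwd.hd_tpath[OF Q]
    have "fcell F \<phi> = ccomp L (ccomp L (hd (tpath L \<zeta> ?Q)) [fcell G \<phi>]) (tpath L \<xi> ?P)"
      using conj_natural[OF assms \<phi>] L.ccomp_assoc_single[OF L.ccomp_single(1)[OF G \<zeta>Q]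
        composable_compose[OF fwd.cell_path_tpath[OF P] G]]
      by (simp add: conj_def)
    then show "ccomp L (fcell F \<phi>) (tpath L \<zeta> ?P) = ccomp L (hd (tpath L \<zeta> ?Q)) [fcell G \<phi>]"
      using swap.cancel_source[OF L.ccomp_single(2)[OF G \<zeta>Q] P] by simp
  qed (auto simp: bwd.ob_comp bwd.horiz_comp)
qed

lemma invertible:
  assumes "avdc_trans K L F G \<xi>"
  shows "invertible_trans K L F G \<xi>"
  using assms inverse_trans left_inv right_inv by (auto simp: invertible_trans_def)

end

lemma invertible_trans_sym:
  assumes "invertible_trans K L F G \<xi>"
  obtains \<zeta> where "invertible_trans K L G F \<zeta>"
  using assms unfolding invertible_trans_def by blast

section \<open>Whiskering\<close>

definition whisker ::
  "('p, 'k, 'x, 'e) avdc_trans_data \<Rightarrow> ('o, 'v, 'h, 'c, 'p, 'w, 'k, 'd) avdc_map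
     \<Rightarrow> ('o, 'h, 'x, 'e) avdc_trans_data" where
  "whisker \<xi> F = \<lparr>tob = tob \<xi> \<circ> fob F, thoriz = thoriz \<xi> \<circ> fhoriz F\<rparr>"

lemma tpath_whisker: "tpath M (whisker \<xi> F) P = tpath M \<xi> (fpath F P)"
  by (simp add: tpath_def whisker_def fpath_def)

text \<open>Naturality at \<open>\<phi>\<close> is naturality of \<open>\<xi>\<close> at
  \<open>F \<phi>\<close>, because the components of the whiskering along a path are those of
  \<open>\<xi>\<close> along its image.\<close>

lemma trans_whisker:
  assumes "avdc_functor K L F" "avdc_trans L M G H \<xi>"
  shows "avdc_trans K M (functor_comp G F) (functor_comp H F) (whisker \<xi> F)"
proof -
  interpret F: avdc_functor K L F by fact
  interpret \<xi>: avdc_trans L M G H \<xi> by fact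
  interpret GF: avdc_functor K M "functor_comp G F"
    using avdc_functor_comp \<xi>.F.avdc_functor_axioms assms(1) by blast
  interpret HF: avdc_functor K M "functor_comp H F"
    using avdc_functor_comp \<xi>.G.avdc_functor_axioms assms(1) by blast
  show ?thesis
  proof unfold_locales
    fix A assume "A \<in> Ob K"
    then show "tob (whisker \<xi> F) A \<in> vhom M (fob (functor_comp G F) A) (fob (functor_comp H F) A)"
      by (simp add: whisker_def \<xi>.tob_in F.fob_in)
  next
    fix f A C assume "f \<in> vhom K A C"
    then show "vcomp M (fvert (functor_comp H F) f) (tob (whisker \<xi> F) A) =
        vcomp M (tob (whisker \<xi> F) C) (fvert (functor_comp G F) f)"
      using \<xi>.tob_natural[OF F.fvert_in] by (simp add: whisker_def)
  next
    fix J assume "J \<in> Horiz K"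
    then show "thoriz (whisker \<xi> F) J
        \<in> cells M (single M (fhoriz (functor_comp G F) J)) (single M (fhoriz (functor_comp H F) J))
          (tob (whisker \<xi> F) (hsrc K J)) (tob (whisker \<xi> F) (htgt K J))"
      using \<xi>.thoriz_in[OF F.fhoriz_in] by (simp add: whisker_def F.fhoriz_hsrc F.fhoriz_htgt)
  next
    fix \<phi> assume "\<phi> \<in> Cell K"
    then have "fcell F \<phi> \<in> cells L (fpath F (csrc K \<phi>)) (fpath F (ctgt K \<phi>))
        (fvert F (cvsrc K \<phi>)) (fvert F (cvtgt K \<phi>))"
      using F.fcell_in by (simp add: cells_iff)
    then show "ccomp M (fcell (functor_comp H F) \<phi>) (tpath M (whisker \<xi> F) (csrc K \<phi>)) =
        ccomp M (hd (tpath M (whisker \<xi> F) (ctgt K \<phi>))) [fcell (functor_comp G F) \<phi>]"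
      using \<xi>.naturality[of "fcell F \<phi>"] by (simp add: tpath_whisker cells_iff)
  qed
qed

lemma invertible_whisker:
  assumes F: "avdc_functor K L F" and \<xi>: "invertible_trans L M G H \<xi>"
  shows "invertible_trans K M (functor_comp G F) (functor_comp H F) (whisker \<xi> F)"
proof -
  interpret F: avdc_functor K L F by fact
  obtain \<zeta> where \<zeta>: "avdc_trans L M G H \<xi>" "avdc_trans L M H G \<zeta>"
      "trans_eq L (trans_comp M \<zeta> \<xi>) (id_trans M G)" "trans_eq L (trans_comp M \<xi> \<zeta>) (id_trans M H)"
    using \<xi> by (auto simp: invertible_trans_def)
  have "trans_eq K (trans_comp M (whisker \<zeta> F) (whisker \<xi> F)) (id_trans M (functor_comp G F))"
    "trans_eq K (trans_comp M (whisker \<xi> F) (whisker \<zeta> F)) (id_trans M (functor_comp H F))"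
    using \<zeta>(3,4) F.fob_in F.fhoriz_in
    by (auto simp: trans_eq_def trans_comp_def whisker_def id_trans_def)
  then show ?thesis
    using trans_whisker[OF F \<zeta>(1)] trans_whisker[OF F \<zeta>(2)] by (auto simp: invertible_trans_def)
qed

section \<open>Reflecting transformations along full and faithful functors\<close>

lemma faithful_cells:
  assumes "avdc K" "faithful K L F" "\<phi> \<in> cells K P Q f g" "\<phi>' \<in> cells K P Q f g" "fcell F \<phi> = fcell F \<phi>'"
  shows "\<phi> = \<phi>'"
  using assms avdc.cells_boundary[OF assms(1,3)] unfolding faithful_def locally_faithful_def
  by (meson inj_onD)

lemma faithful_vhom:
  assumes "avdc K" "faithful K L F" "f \<in> vhom K A B" "f' \<in> vhom K A B" "fvert F f = fvert F f'"
  shows "f = f'"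
proof -
  have "A \<in> Ob K" "B \<in> Ob K"
    using assms(1,3) avdc.vdom_in avdc.vcod_in by (auto simp: vhom_iff)
  then show ?thesis using assms unfolding faithful_def by (meson inj_onD)
qed

lemma full_cells:
  assumes "full K L F" "boundary K P Q f g" "\<chi> \<in> cells L (fpath F P) (fpath F Q) (fvert F f) (fvert F g)"
  obtains \<phi> where "\<phi> \<in> cells K P Q f g" "fcell F \<phi> = \<chi>"
proof -
  have "\<chi> \<in> fcell F ` cells K P Q f g"
    using assms(1-3) unfolding full_def locally_full_def by blast
  then show ?thesis using that by blast
qed

lemma full_vhom:
  assumes "full K L F" "A \<in> Ob K" "B \<in> Ob K" "e \<in> vhom L (fob F A) (fob F B)"
  obtains f where "f \<in> vhom K A B" "fvert F f = e"
proof -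
  have "e \<in> fvert F ` vhom K A B"
    using assms(1-4) unfolding full_def by blast
  then show ?thesis using that by blast
qed

text \<open>Fullness provides preimages of the components of \<open>\<theta>\<close>; faithfulness
  pulls the naturality equations of \<open>\<theta>\<close> back along \<open>F\<close>.\<close>

lemma trans_reflect:
  assumes F: "avdc_functor K L F" "full K L F" "faithful K L F"
    and H: "avdc_functor M K H" "avdc_functor M K H'"
    and \<theta>: "avdc_trans M L (functor_comp F H) (functor_comp F H') \<theta>"
  obtains \<xi> where "avdc_trans M K H H' \<xi>"
    "\<And>A. A \<in> Ob M \<Longrightarrow> fvert F (tob \<xi> A) = tob \<theta> A"
    "\<And>J. J \<in> Horiz M \<Longrightarrow> fcell F (thoriz \<xi> J) = thoriz \<theta> J"
proof -
  interpret F: avdc_functor K L F by fact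
  interpret H: avdc_functor M K H by fact
  interpret H': avdc_functor M K H' by fact
  interpret \<theta>: avdc_trans M L "functor_comp F H" "functor_comp F H'" \<theta> by fact
  have "\<exists>f. f \<in> vhom K (fob H A) (fob H' A) \<and> fvert F f = tob \<theta> A" if "A \<in> Ob M" for A
  proof -
    have "tob \<theta> A \<in> vhom L (fob F (fob H A)) (fob F (fob H' A))"
      using \<theta>.tob_in[OF that] by simp
    then show ?thesis
      using full_vhom[OF F(2) H.fob_in[OF that] H'.fob_in[OF that]] by blast
  qed
  then obtain t where t: "\<And>A. A \<in> Ob M \<Longrightarrow> t A \<in> vhom K (fob H A) (fob H' A) \<and> fvert F (t A) = tob \<theta> A"
    by metis
  have "\<exists>\<phi>. \<phi> \<in> cells K (single K (fhoriz H J)) (single K (fhoriz H' J)) (t (hsrc M J)) (t (htgt M J)) \<and>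
      fcell F \<phi> = thoriz \<theta> J" if J: "J \<in> Horiz M" for J
  proof -
    have ts: "t (hsrc M J) \<in> vhom K (fob H (hsrc M J)) (fob H' (hsrc M J))"
      "t (htgt M J) \<in> vhom K (fob H (htgt M J)) (fob H' (htgt M J))"
      using t H.K.hsrc_in H.K.htgt_in J by auto
    have b: "boundary K (single K (fhoriz H J)) (single K (fhoriz H' J)) (t (hsrc M J)) (t (htgt M J))"
      using ts J H.fhoriz_in H'.fhoriz_in H.fhoriz_hsrc H'.fhoriz_hsrc H.fhoriz_htgt H'.fhoriz_htgt
        H.fob_in[OF H.K.htgt_in[OF J]] H'.fob_in[OF H.K.htgt_in[OF J]]
      by (auto simp: boundary_def vhom_iff is_hpath_def single_def)
    have \<theta>J: "thoriz \<theta> J \<in> cells L (fpath F (single K (fhoriz H J))) (fpath F (single K (fhoriz H' J)))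
        (fvert F (t (hsrc M J))) (fvert F (t (htgt M J)))"
      using \<theta>.thoriz_in[OF J] t H.K.hsrc_in[OF J] H.K.htgt_in[OF J]
        F.graph.fpath_single[OF H.fhoriz_in[OF J]] F.graph.fpath_single[OF H'.fhoriz_in[OF J]] by simp
    show ?thesis
      using full_cells[OF F(2) b \<theta>J] by blast
  qed
  then obtain h where h: "\<And>J. J \<in> Horiz M \<Longrightarrow>
      h J \<in> cells K (single K (fhoriz H J)) (single K (fhoriz H' J)) (t (hsrc M J)) (t (htgt M J)) \<and>
      fcell F (h J) = thoriz \<theta> J" by metis
  define \<xi> where "\<xi> = \<lparr>tob = t, thoriz = h\<rparr>"
  interpret \<xi>: avdc_family M K H H' \<xi>
    using t h by unfold_locales (auto simp: \<xi>_def)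
  \<comment> \<open>This includes empty paths, where \<open>F\<close> preserves the vertical
    identity cell that serves as component.\<close>
  have map_tpath: "map (fcell F) (tpath K \<xi> P) = tpath L \<theta> P" if P: "is_hpath M P A B" for P A B
  proof (cases "snd P = []")
    case True
    then show ?thesis
      using t[of "fst P"] H.K.hpath_objects(1,3)[OF P] F.fcell_vidc[of "t (fst P)"]
      by (simp add: tpath_def \<xi>_def vhom_iff)
  next
    case False
    have "set (snd P) \<subseteq> Horiz M"
    proof -
      have "set Js \<subseteq> Horiz M" if "is_walk M A Js B" for A Js
        using that by (induction Js arbitrary: A) auto
      then show ?thesis using P by (auto simp: is_hpath_def)
    qed
    then show ?thesis using False h by (auto simp: tpath_def \<xi>_def)
  qed
  \<comment> \<open>Vertical naturality has to precede naturality on cells: local faithfulness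
    compares only cells with equal boundary, and this equation gives both sides of the cell equation
    the same one.\<close>
  have nat: "vcomp K (fvert H' f) (tob \<xi> A) = vcomp K (tob \<xi> C) (fvert H f)"
    if f: "f \<in> vhom M A C" for f A C
  proof -
    have ob: "A \<in> Ob M" "C \<in> Ob M" using f H.K.vdom_in H.K.vcod_in by (auto simp: vhom_iff)
    note in1 = \<xi>.ob_comp[OF ob(1)] \<xi>.ob_comp[OF ob(2)] and in2 = H.fvert_in[OF f] H'.fvert_in[OF f]
    show ?thesis
      using faithful_vhom[OF F.K.avdc_axioms F(3) F.K.vcomp_in[OF in1(1) in2(2)]
          F.K.vcomp_in[OF in2(1) in1(2)]]
        F.fvert_vcomp[OF in1(1) in2(2)] F.fvert_vcomp[OF in2(1) in1(2)] \<theta>.tob_natural[OF f] t ob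
      by (simp add: \<xi>_def)
  qed
  have "avdc_trans M K H H' \<xi>"
  proof unfold_locales
    fix f A C assume "f \<in> vhom M A C"
    then show "vcomp K (fvert H' f) (tob \<xi> A) = vcomp K (tob \<xi> C) (fvert H f)" by (rule nat)
  next
    fix \<phi> assume \<phi>: "\<phi> \<in> Cell M"
    let ?P = "csrc M \<phi>" and ?Q = "ctgt M \<phi>" and ?f = "cvsrc M \<phi>" and ?g = "cvtgt M \<phi>"
    from \<phi> obtain A B C D where \<phi>': "\<phi> \<in> cells M ?P ?Q ?f ?g"
      and P: "is_hpath M ?P A B" and Q: "is_hpath M ?Q C D" "length (snd ?Q) \<le> 1"
      and fg: "?f \<in> vhom M A C" "?g \<in> vhom M B D"
      using H.K.cell_dest by metis
    have ob: "A \<in> Ob M" "B \<in> Ob M" "C \<in> Ob M" "D \<in> Ob M" using H.K.hpath_objects P Q by blast+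
    note HP = H'.fcell_in[OF \<phi>'] and HQ = H.fcell_in[OF \<phi>']
    note \<xi>P = \<xi>.cell_path_tpath[OF P] and \<xi>Q = \<xi>.hd_tpath[OF Q]
    show "ccomp K (fcell H' \<phi>) (tpath K \<xi> ?P) = ccomp K (hd (tpath K \<xi> ?Q)) [fcell H \<phi>]"
    proof (rule faithful_cells[OF F.K.avdc_axioms F(3)])
      show "ccomp K (fcell H' \<phi>) (tpath K \<xi> ?P) \<in> cells K (fpath H ?P) (fpath H' ?Q)
          (vcomp K (fvert H' ?f) (tob \<xi> A)) (vcomp K (fvert H' ?g) (tob \<xi> B))"
        by (rule F.K.ccomp_cell_path[OF \<xi>P HP])
      show "ccomp K (hd (tpath K \<xi> ?Q)) [fcell H \<phi>] \<in> cells K (fpath H ?P) (fpath H' ?Q)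
          (vcomp K (fvert H' ?f) (tob \<xi> A)) (vcomp K (fvert H' ?g) (tob \<xi> B))"
        using F.K.ccomp_single(2)[OF HQ \<xi>Q] nat[OF fg(1)] nat[OF fg(2)] by simp
      have "fcell F (hd (tpath K \<xi> ?Q)) = hd (tpath L \<theta> ?Q)"
        using map_tpath[OF Q(1)] \<xi>.tpath_singleton[OF Q(2)] by (metis list.sel(1) list.simps(9))
      then show "fcell F (ccomp K (fcell H' \<phi>) (tpath K \<xi> ?P)) =
          fcell F (ccomp K (hd (tpath K \<xi> ?Q)) [fcell H \<phi>])"
        using F.fcell_ccomp[OF composable_compose[OF \<xi>P HP]] F.fcell_ccomp[OF F.K.ccomp_single(1)[OF HQ \<xi>Q]]
          map_tpath[OF P] \<theta>.naturality[OF \<phi>] by simp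
    qed
  qed (auto intro: \<xi>.ob_comp \<xi>.horiz_comp)
  then show thesis using that t h by (simp add: \<xi>_def)
qed

text \<open>The inverse law holds after applying \<open>F\<close>, so faithfulness gives it in
  \<open>K\<close>. The vertical law comes first, as it gives the two cells in the horizontal law a
  common boundary.\<close>

lemma trans_eq_reflect:
  assumes F: "avdc_functor K L F" "faithful K L F"
    and \<xi>: "avdc_trans M K H H' \<xi>" "avdc_trans M K H' H \<zeta>"
    and F\<xi>: "\<And>A. A \<in> Ob M \<Longrightarrow> fvert F (tob \<xi> A) = tob \<theta> A"
      "\<And>J. J \<in> Horiz M \<Longrightarrow> fcell F (thoriz \<xi> J) = thoriz \<theta> J"
    and F\<zeta>: "\<And>A. A \<in> Ob M \<Longrightarrow> fvert F (tob \<zeta> A) = tob \<theta>' A"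
      "\<And>J. J \<in> Horiz M \<Longrightarrow> fcell F (thoriz \<zeta> J) = thoriz \<theta>' J"
    and eq: "trans_eq M (trans_comp L \<theta>' \<theta>) (id_trans L (functor_comp F H))"
  shows "trans_eq M (trans_comp K \<zeta> \<xi>) (id_trans K H)"
proof -
  interpret F: avdc_functor K L F by fact
  interpret \<xi>: avdc_trans M K H H' \<xi> by fact
  interpret \<zeta>: avdc_trans M K H' H \<zeta> by fact
  have ob: "vcomp K (tob \<zeta> A) (tob \<xi> A) = vid K (fob H A)" if A: "A \<in> Ob M" for A
  proof (rule faithful_vhom[OF F.K.avdc_axioms F(2)])
    show "vcomp K (tob \<zeta> A) (tob \<xi> A) \<in> vhom K (fob H A) (fob H A)"
      using F.K.vcomp_in \<xi>.tob_in \<zeta>.tob_in A by blast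
    show "vid K (fob H A) \<in> vhom K (fob H A) (fob H A)"
      using F.K.vid_in \<xi>.F.fob_in A by blast
    show "fvert F (vcomp K (tob \<zeta> A) (tob \<xi> A)) = fvert F (vid K (fob H A))"
      using F.fvert_vcomp[OF \<xi>.tob_in[OF A] \<zeta>.tob_in[OF A]] F.fvert_vid[OF \<xi>.F.fob_in[OF A]]
        F\<xi>(1) F\<zeta>(1) eq A by (simp add: trans_eq_def trans_comp_def id_trans_def)
  qed
  have "ccomp K (thoriz \<zeta> J) [thoriz \<xi> J] = hidc K (fhoriz H J)" if J: "J \<in> Horiz M" for J
  proof (rule faithful_cells[OF F.K.avdc_axioms F(2)])
    note s = F.K.ccomp_single[OF \<xi>.thoriz_in[OF J] \<zeta>.thoriz_in[OF J]]
    show "ccomp K (thoriz \<zeta> J) [thoriz \<xi> J] \<in> cells K (single K (fhoriz H J)) (single K (fhoriz H J))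
        (vid K (fob H (hsrc M J))) (vid K (fob H (htgt M J)))"
      using s(2) ob \<xi>.F.K.hsrc_in \<xi>.F.K.htgt_in J by simp
    show "hidc K (fhoriz H J) \<in> cells K (single K (fhoriz H J)) (single K (fhoriz H J))
        (vid K (fob H (hsrc M J))) (vid K (fob H (htgt M J)))"
      using F.K.hidc_in[OF \<xi>.F.fhoriz_in[OF J]] \<xi>.F.fhoriz_hsrc \<xi>.F.fhoriz_htgt J by simp
    show "fcell F (ccomp K (thoriz \<zeta> J) [thoriz \<xi> J]) = fcell F (hidc K (fhoriz H J))"
      using F.fcell_ccomp[OF s(1)] F.fcell_hidc[OF \<xi>.F.fhoriz_in[OF J]] F\<xi>(2) F\<zeta>(2) eq J
      by (simp add: trans_eq_def trans_comp_def id_trans_def)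
  qed
  then show ?thesis using ob by (simp add: trans_eq_def trans_comp_def id_trans_def)
qed

text \<open>The transformation \<open>\<theta>\<close> and its inverse are reflected separately, and
  faithfulness makes the results mutually inverse. With \<open>H\<close> the composite
  \<open>GF\<close> and \<open>H'\<close> the identity, this produces the missing isomorphism of a
  pseudo-inverse.\<close>

lemma invertible_reflect:
  assumes F: "avdc_functor K L F" "full K L F" "faithful K L F"
    and H: "avdc_functor M K H" "avdc_functor M K H'"
    and \<theta>: "invertible_trans M L (functor_comp F H) (functor_comp F H') \<theta>"
  obtains \<xi> where "invertible_trans M K H H' \<xi>"
proof -
  obtain \<theta>' where \<theta>': "avdc_trans M L (functor_comp F H) (functor_comp F H') \<theta>"
      "avdc_trans M L (functor_comp F H') (functor_comp F H) \<theta>'"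
      "trans_eq M (trans_comp L \<theta>' \<theta>) (id_trans L (functor_comp F H))"
      "trans_eq M (trans_comp L \<theta> \<theta>') (id_trans L (functor_comp F H'))"
    using \<theta> by (auto simp: invertible_trans_def)
  obtain \<xi> where \<xi>: "avdc_trans M K H H' \<xi>"
    "\<And>A. A \<in> Ob M \<Longrightarrow> fvert F (tob \<xi> A) = tob \<theta> A"
    "\<And>J. J \<in> Horiz M \<Longrightarrow> fcell F (thoriz \<xi> J) = thoriz \<theta> J"
    using trans_reflect[OF F H \<theta>'(1)] by metis
  obtain \<zeta> where \<zeta>: "avdc_trans M K H' H \<zeta>"
    "\<And>A. A \<in> Ob M \<Longrightarrow> fvert F (tob \<zeta> A) = tob \<theta>' A"
    "\<And>J. J \<in> Horiz M \<Longrightarrow> fcell F (thoriz \<zeta> J) = thoriz \<theta>' J"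
    using trans_reflect[OF F H(2,1) \<theta>'(2)] by metis
  have "invertible_trans M K H H' \<xi>"
    unfolding invertible_trans_def
    using \<xi>(1) \<zeta>(1) trans_eq_reflect[OF F(1,3) \<xi>(1) \<zeta>(1) \<xi>(2,3) \<zeta>(2,3) \<theta>'(3)]
      trans_eq_reflect[OF F(1,3) \<zeta>(1) \<xi>(1) \<zeta>(2,3) \<xi>(2,3) \<theta>'(4)] by blast
  then show thesis by (rule that)
qed

section \<open>Construction of the pseudo-inverse\<close>

lemma (in avdc) is_walk_append:
  "is_walk K A (Js @ Js') C \<longleftrightarrow> (\<exists>B. is_walk K A Js B \<and> is_walk K B Js' C)"
  using walk_objects(1) by (induction Js arbitrary: A) auto

lemma is_walk_end_unique: "is_walk K A Js B \<Longrightarrow> is_walk K A Js B' \<Longrightarrow> B = B'"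
  by (induction Js arbitrary: A) auto

lemma (in avdc) ctgts_hpath:
  assumes "\<phi>s \<noteq> []" "set \<phi>s \<subseteq> Cell K" "successively (\<lambda>\<phi> \<phi>'. cvtgt K \<phi> = cvsrc K \<phi>') \<phi>s"
  shows "is_hpath K (hconcat (map (ctgt K) \<phi>s)) (vcod K (cvsrc K (hd \<phi>s))) (vcod K (cvtgt K (last \<phi>s)))"
  using assms
proof (induction \<phi>s rule: list_nonempty_induct)
  case (single \<phi>)
  then show ?case using ctgt_path by simp
next
  case (cons \<phi> \<phi>s)
  then have "is_hpath K (ctgt K \<phi>) (vcod K (cvsrc K \<phi>)) (vcod K (cvtgt K \<phi>))"
    "is_hpath K (hconcat (map (ctgt K) \<phi>s)) (vcod K (cvtgt K \<phi>)) (vcod K (cvtgt K (last \<phi>s)))"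
    using ctgt_path[of \<phi>] by (auto simp: successively_Cons)
  then show ?case using cons.hyps is_walk_append by (auto simp: is_hpath_def hconcat_def)
qed

text \<open>\<open>composable\<close> matches horizontal paths only and does not mention
  composability of the outer vertical morphisms. It follows by comparing the two endpoints of the
  source of \<open>\<psi>\<close>, since the end of a walk is determined by its start and its
  edges.\<close>

lemma (in avdc) composable_vert:
  assumes "composable K \<psi> \<phi>s"
  shows "cvsrc K (hd \<phi>s) \<in> vhom K (vdom K (cvsrc K (hd \<phi>s))) (vdom K (cvsrc K \<psi>))"
    "cvsrc K \<psi> \<in> vhom K (vdom K (cvsrc K \<psi>)) (vcod K (cvsrc K \<psi>))"
    "cvtgt K (last \<phi>s) \<in> vhom K (vdom K (cvtgt K (last \<phi>s))) (vdom K (cvtgt K \<psi>))"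
    "cvtgt K \<psi> \<in> vhom K (vdom K (cvtgt K \<psi>)) (vcod K (cvtgt K \<psi>))"
proof -
  have c: "\<psi> \<in> Cell K" "\<phi>s \<noteq> []" "hd \<phi>s \<in> Cell K" "last \<phi>s \<in> Cell K"
    using composable_cells[OF assms] by auto
  have "is_hpath K (csrc K \<psi>) (vcod K (cvsrc K (hd \<phi>s))) (vcod K (cvtgt K (last \<phi>s)))"
    using ctgts_hpath[of \<phi>s] assms by (auto simp: composable_def)
  then have "vcod K (cvsrc K (hd \<phi>s)) = vdom K (cvsrc K \<psi>)"
    "vcod K (cvtgt K (last \<phi>s)) = vdom K (cvtgt K \<psi>)"
    using csrc_path[OF c(1)] is_walk_end_unique unfolding is_hpath_def by metis+
  then show "cvsrc K (hd \<phi>s) \<in> vhom K (vdom K (cvsrc K (hd \<phi>s))) (vdom K (cvsrc K \<psi>))"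
    "cvsrc K \<psi> \<in> vhom K (vdom K (cvsrc K \<psi>)) (vcod K (cvsrc K \<psi>))"
    "cvtgt K (last \<phi>s) \<in> vhom K (vdom K (cvtgt K (last \<phi>s))) (vdom K (cvtgt K \<psi>))"
    "cvtgt K \<psi> \<in> vhom K (vdom K (cvtgt K \<psi>)) (vcod K (cvtgt K \<psi>))"
    using c cvsrc_in cvtgt_in by (auto simp: vhom_iff)
qed

section \<open>Functoriality of the lifted action\<close>

text \<open>Collects the outcome of all choices: \<open>G\<close> on objects and horizontal
  morphisms, the family \<open>\<sigma>\<close> with inverse \<open>\<tau>\<close>, and an action of
  \<open>G\<close> on vertical morphisms and cells whose image under \<open>F\<close> is conjugation
  by \<open>\<sigma>\<close>. None of the functor axioms for this action is assumed; they are
  derived from faithfulness.\<close>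

locale avdc_lift = K: avdc K + L: avdc L + iso: avdc_iso_family L L "functor_comp F G" id_functor \<sigma> \<tau> +
    F: avdc_functor K L F + G: avdc_graph_map L K G
  for K :: "('o, 'v, 'h, 'c) avdc_data" and L :: "('p, 'w, 'k, 'd) avdc_data"
    and F :: "('o, 'v, 'h, 'c, 'p, 'w, 'k, 'd) avdc_map"
    and G :: "('p, 'w, 'k, 'd, 'o, 'v, 'h, 'c) avdc_map" and \<sigma> \<tau> +
  assumes faithful: "faithful K L F"
    and lift_vert: "f \<in> vhom L A B \<Longrightarrow> fvert G f \<in> vhom K (fob G A) (fob G B)"
    and F_lift_vert: "f \<in> vhom L A B \<Longrightarrow> fvert F (fvert G f) = iso.vconj A B f"
    and lift_cell: "\<phi> \<in> cells L P Q f g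
      \<Longrightarrow> fcell G \<phi> \<in> cells K (fpath G P) (fpath G Q) (fvert G f) (fvert G g)"
    and F_lift_cell: "\<phi> \<in> Cell L \<Longrightarrow> fcell F (fcell G \<phi>) = iso.conj (csrc L \<phi>) (ctgt L \<phi>) \<phi>"
begin

lemma vobs: "f \<in> vhom L A B \<Longrightarrow> A \<in> Ob L \<and> B \<in> Ob L"
  using L.vdom_in L.vcod_in by (auto simp: vhom_iff)

lemma \<sigma>_in: "A \<in> Ob L \<Longrightarrow> tob \<sigma> A \<in> vhom L (fob F (fob G A)) A"
  using iso.fwd.ob_comp by simp

lemma vert_natural:
  assumes "f \<in> vhom L A B"
  shows "vcomp L f (tob \<sigma> A) = vcomp L (tob \<sigma> B) (fvert F (fvert G f))"
  using iso.vconj_iff[of f A B "fvert F (fvert G f)"] F_lift_vert[OF assms]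
    F.fvert_in[OF lift_vert[OF assms]] vobs[OF assms] assms by simp

text \<open>The equation defining \<open>fcell G\<close>, solved for naturality of
  \<open>\<sigma>\<close> by \<open>conj_iff\<close>. It is available before \<open>G\<close> is
  known to be a functor and drives the proof that \<open>G\<close> preserves composition.\<close>

lemma cell_natural:
  assumes "\<phi> \<in> Cell L"
  shows "ccomp L \<phi> (tpath L \<sigma> (csrc L \<phi>)) = ccomp L (hd (tpath L \<sigma> (ctgt L \<phi>))) [fcell F (fcell G \<phi>)]"
proof -
  obtain A B C D where c: "\<phi> \<in> cells L (csrc L \<phi>) (ctgt L \<phi>) (cvsrc L \<phi>) (cvtgt L \<phi>)"
    and p: "is_hpath L (csrc L \<phi>) A B" "is_hpath L (ctgt L \<phi>) C D" "length (snd (ctgt L \<phi>)) \<le> 1"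
    using L.cell_dest[OF assms] by metis
  have \<phi>: "\<phi> \<in> cells L (fpath id_functor (csrc L \<phi>)) (fpath id_functor (ctgt L \<phi>)) (cvsrc L \<phi>) (cvtgt L \<phi>)"
    using c by simp
  have FG\<phi>: "fcell F (fcell G \<phi>) \<in> cells L (fpath (functor_comp F G) (csrc L \<phi>))
      (fpath (functor_comp F G) (ctgt L \<phi>)) (fvert F (fvert G (cvsrc L \<phi>))) (fvert F (fvert G (cvtgt L \<phi>)))"
    using F.fcell_in[OF lift_cell[OF c]] by (simp add: fpath_functor_comp)
  show ?thesis
    using iso.conj_iff[OF \<phi> FG\<phi> p] F_lift_cell[OF assms] by simp
qed

lemma vert_unique:
  assumes f: "f \<in> vhom L A B" and x: "x \<in> vhom K (fob G A) (fob G B)"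
    and nat: "vcomp L f (tob \<sigma> A) = vcomp L (tob \<sigma> B) (fvert F x)"
  shows "fvert G f = x"
proof (rule faithful_vhom[OF K.avdc_axioms faithful lift_vert[OF f] x])
  show "fvert F (fvert G f) = fvert F x"
    using iso.vconj_iff[of f A B "fvert F x"] F_lift_vert[OF f] F.fvert_in[OF x] vobs[OF f] nat f by simp
qed

text \<open>The naturality equation determines the image under \<open>F\<close>, and faithfulness
  then determines the cell. Each functor axiom on cells reduces to checking this equation for the
  expected value, as \<open>vert_unique\<close> does for vertical morphisms.\<close>

lemma cell_unique:
  assumes \<phi>: "\<phi> \<in> cells L P Q f g" and x: "x \<in> cells K (fpath G P) (fpath G Q) (fvert G f) (fvert G g)"
    and nat: "ccomp L \<phi> (tpath L \<sigma> P) = ccomp L (hd (tpath L \<sigma> Q)) [fcell F x]"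
  shows "fcell G \<phi> = x"
proof (rule faithful_cells[OF K.avdc_axioms faithful lift_cell[OF \<phi>] x])
  have \<phi>': "\<phi> \<in> Cell L" "csrc L \<phi> = P" "ctgt L \<phi> = Q" using \<phi> by (auto simp: cells_iff)
  obtain A B C D where p: "is_hpath L P A B" "is_hpath L Q C D" "length (snd Q) \<le> 1"
    using L.cell_dest[OF \<phi>'(1)] \<phi>'(2,3) by metis
  have id\<phi>: "\<phi> \<in> cells L (fpath id_functor P) (fpath id_functor Q) f g"
    using \<phi> by simp
  have Fx: "fcell F x \<in> cells L (fpath (functor_comp F G) P) (fpath (functor_comp F G) Q)
      (fvert F (fvert G f)) (fvert F (fvert G g))"
    using F.fcell_in[OF x] by (simp add: fpath_functor_comp)
  show "fcell F (fcell G \<phi>) = fcell F x"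
    using iso.conj_iff[OF id\<phi> Fx p] F_lift_cell[OF \<phi>'(1)] nat \<phi>'(2,3) by simp
qed

lemma lift_vid:
  assumes "A \<in> Ob L"
  shows "fvert G (vid L A) = vid K (fob G A)"
  using vert_unique[OF L.vid_in[OF assms] K.vid_in[OF G.ob_in[OF assms]]]
    L.vcomp_vid_left[OF \<sigma>_in[OF assms]] L.vcomp_vid_right[OF \<sigma>_in[OF assms]]
    F.fvert_vid[OF G.ob_in[OF assms]] by simp

lemma lift_vcomp:
  assumes f: "f \<in> vhom L A B" and g: "g \<in> vhom L B C"
  shows "fvert G (vcomp L g f) = vcomp K (fvert G g) (fvert G f)"
proof (rule vert_unique[OF L.vcomp_in[OF f g] K.vcomp_in[OF lift_vert[OF f] lift_vert[OF g]]])
  note ob = vobs[OF f] vobs[OF g]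
  note Ff = F.fvert_in[OF lift_vert[OF f]] and Fg = F.fvert_in[OF lift_vert[OF g]]
  have "vcomp L (vcomp L g f) (tob \<sigma> A) = vcomp L g (vcomp L (tob \<sigma> B) (fvert F (fvert G f)))"
    using L.vcomp_assoc[OF \<sigma>_in f g] ob vert_natural[OF f] by simp
  also have "\<dots> = vcomp L (vcomp L (tob \<sigma> C) (fvert F (fvert G g))) (fvert F (fvert G f))"
    using L.vcomp_assoc[OF Ff \<sigma>_in g] ob vert_natural[OF g] by simp
  also have "\<dots> = vcomp L (tob \<sigma> C) (fvert F (vcomp K (fvert G g) (fvert G f)))"
    using L.vcomp_assoc[OF Ff Fg \<sigma>_in] ob F.fvert_vcomp[OF lift_vert[OF f] lift_vert[OF g]] by simp
  finally show "vcomp L (vcomp L g f) (tob \<sigma> A) = vcomp L (tob \<sigma> C) (fvert F (vcomp K (fvert G g) (fvert G f)))" .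
qed

text \<open>The composite of the lifts satisfies the naturality equation of the composite:
  \<open>\<sigma>\<close> is moved past \<open>\<psi>\<close> and then past every cell of the row.
  Absorption mediates between components along a concatenated path and concatenated
  components.\<close>

lemma lift_ccomp:
  assumes comp: "composable L \<psi> \<phi>s"
  shows "fcell G (ccomp L \<psi> \<phi>s) = ccomp K (fcell G \<psi>) (map (fcell G) \<phi>s)"
proof (rule cell_unique)
  let ?P = "hconcat (map (csrc L) \<phi>s)" and ?R = "ctgt L \<psi>"
  let ?\<sigma> = "tpath L \<sigma>" and ?FG = "\<lambda>\<phi>. fcell F (fcell G \<phi>)"
  let ?f = "vcomp L (cvsrc L \<psi>) (cvsrc L (hd \<phi>s))" and ?g = "vcomp L (cvtgt L \<psi>) (cvtgt L (last \<phi>s))"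
  show in_L: "ccomp L \<psi> \<phi>s \<in> cells L ?P ?R ?f ?g"
    by (rule L.ccomp_in[OF comp])
  note c = composable_cells[OF comp]
  have compK: "composable K (fcell G \<psi>) (map (fcell G) \<phi>s)"
    by (rule composable_map_cells[OF lift_cell comp])
  have G_cell: "fcell G \<phi> \<in> cells K (fpath G (csrc L \<phi>)) (fpath G (ctgt L \<phi>))
      (fvert G (cvsrc L \<phi>)) (fvert G (cvtgt L \<phi>))" if "\<phi> \<in> Cell L" for \<phi>
    using lift_cell that by (simp add: cells_iff)
  have FG_cell: "?FG \<phi> \<in> cells L (fpath F (fpath G (csrc L \<phi>))) (fpath F (fpath G (ctgt L \<phi>)))
      (fvert F (fvert G (cvsrc L \<phi>))) (fvert F (fvert G (cvtgt L \<phi>)))" if "\<phi> \<in> Cell L" for \<phi>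
    using F.fcell_in[OF G_cell[OF that]] .
  have compL: "composable L (?FG \<psi>) (map ?FG \<phi>s)"
    using composable_map_cells[OF F.fcell_in compK] by (simp add: comp_def)
  obtain A B C D where \<psi>: "\<psi> \<in> cells L (csrc L \<psi>) ?R (cvsrc L \<psi>) (cvtgt L \<psi>)"
    "is_hpath L (csrc L \<psi>) A B" "is_hpath L ?R C D" "length (snd ?R) \<le> 1"
    using L.cell_dest[OF c(1)] by metis
  have \<sigma>R: "hd (?\<sigma> ?R) \<in> cells L (fpath F (fpath G ?R)) ?R (tob \<sigma> C) (tob \<sigma> D)"
    using iso.fwd.hd_tpath[OF \<psi>(3,4)] by (simp add: fpath_functor_comp)
  show "ccomp K (fcell G \<psi>) (map (fcell G) \<phi>s) \<in> cells K (fpath G ?P) (fpath G ?R) (fvert G ?f) (fvert G ?g)"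
  proof -
    have "map (csrc K) (map (fcell G) \<phi>s) = map (fpath G) (map (csrc L) \<phi>s)"
      using c(2) G_cell by (auto simp: cells_iff)
    then have "hconcat (map (csrc K) (map (fcell G) \<phi>s)) = fpath G ?P"
      using fpath_hconcat[of "map (csrc L) \<phi>s" G] c(3) by (simp only: map_is_Nil_conv) simp
    moreover have "vcomp K (fvert G (cvsrc L \<psi>)) (fvert G (cvsrc L (hd \<phi>s))) = fvert G ?f"
      using lift_vcomp[OF L.composable_vert(1)[OF comp] L.composable_vert(2)[OF comp]] ..
    moreover have "vcomp K (fvert G (cvtgt L \<psi>)) (fvert G (cvtgt L (last \<phi>s))) = fvert G ?g"
      using lift_vcomp[OF L.composable_vert(3)[OF comp] L.composable_vert(4)[OF comp]] ..
    ultimately show ?thesis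
      using K.ccomp_in[OF compK] G_cell c by (simp add: hd_map last_map cells_iff)
  qed
  have s: "hd (?\<sigma> (ctgt L \<phi>)) \<in> cells L (fpath F (fpath G (ctgt L \<phi>))) (ctgt L \<phi>)
      (tob \<sigma> (vcod L (cvsrc L \<phi>))) (tob \<sigma> (vcod L (cvtgt L \<phi>)))"
    "?\<sigma> (ctgt L \<phi>) = [hd (?\<sigma> (ctgt L \<phi>))]"
    "cell_path L (?\<sigma> (csrc L \<phi>)) (fpath F (fpath G (csrc L \<phi>))) (csrc L \<phi>)
      (tob \<sigma> (vdom L (cvsrc L \<phi>))) (tob \<sigma> (vdom L (cvtgt L \<phi>)))"
    "composable L \<phi> (?\<sigma> (csrc L \<phi>))"
    if \<phi>: "\<phi> \<in> Cell L" for \<phi>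
  proof -
    show "hd (?\<sigma> (ctgt L \<phi>)) \<in> cells L (fpath F (fpath G (ctgt L \<phi>))) (ctgt L \<phi>)
      (tob \<sigma> (vcod L (cvsrc L \<phi>))) (tob \<sigma> (vcod L (cvtgt L \<phi>)))"
      using iso.fwd.hd_tpath[OF L.ctgt_path[OF \<phi>] L.ctgt_length[OF \<phi>]]
      by (simp add: fpath_functor_comp)
    show "?\<sigma> (ctgt L \<phi>) = [hd (?\<sigma> (ctgt L \<phi>))]"
      using iso.fwd.tpath_singleton[OF L.ctgt_length[OF \<phi>]] .
    show p: "cell_path L (?\<sigma> (csrc L \<phi>)) (fpath F (fpath G (csrc L \<phi>))) (csrc L \<phi>)
      (tob \<sigma> (vdom L (cvsrc L \<phi>))) (tob \<sigma> (vdom L (cvtgt L \<phi>)))"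
      using iso.fwd.cell_path_tpath[OF L.csrc_path[OF \<phi>]] by (simp add: fpath_functor_comp)
    show "composable L \<phi> (?\<sigma> (csrc L \<phi>))"
      using composable_compose[OF p, of \<phi>] \<phi> by (simp add: cells_iff)
  qed
  \<comment> \<open>Targets have length at most one, so each cell of the row receives exactly one
    component of \<open>\<sigma>\<close>.\<close>
  have s\<phi>: "map (\<lambda>\<phi>. hd (?\<sigma> (ctgt L \<phi>))) \<phi>s = concat (map ?\<sigma> (map (ctgt L) \<phi>s))"
    using c(2) s(2) by (induction \<phi>s) auto
  have adj: "successively (\<lambda>\<phi> \<phi>'. cvtgt L \<phi> = cvsrc L \<phi>') \<phi>s"
    using comp by (simp add: composable_def)
  have set\<phi>s: "set \<phi>s \<subseteq> Cell L" using c(2) by blast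
  have adj_src: "successively (\<lambda>\<phi> \<phi>'. cvtgt L (last (?\<sigma> (csrc L \<phi>))) = cvsrc L (hd (?\<sigma> (csrc L \<phi>')))) \<phi>s"
    using adj set\<phi>s s(3)
    by (induction \<phi>s rule: induct_list012) (auto simp: cell_path_def)
  have adj_FG: "successively (\<lambda>\<phi> \<phi>'. cvtgt L (last [?FG \<phi>]) = cvsrc L (hd [?FG \<phi>'])) \<phi>s"
    using compL by (simp add: composable_def successively_map)
  have adj_s: "successively (\<lambda>\<phi> \<phi>'. cvtgt L (hd (?\<sigma> (ctgt L \<phi>))) = cvsrc L (hd (?\<sigma> (ctgt L \<phi>')))) \<phi>s"
    using adj set\<phi>s s(1)
    by (induction \<phi>s rule: induct_list012) (auto simp: cells_iff)
  have comp_s: "composable L \<psi> (map (\<lambda>\<phi>. hd (?\<sigma> (ctgt L \<phi>))) \<phi>s)"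
  proof -
    have "map (\<lambda>\<phi>. ctgt L (hd (?\<sigma> (ctgt L \<phi>)))) \<phi>s = map (ctgt L) \<phi>s"
      using c(2) s(1) by (auto simp: cells_iff)
    then have "map (ctgt L) (map (\<lambda>\<phi>. hd (?\<sigma> (ctgt L \<phi>))) \<phi>s) = map (ctgt L) \<phi>s"
      by (simp only: map_map comp_def)
    then show ?thesis
      using comp adj_s s(1) c unfolding composable_def successively_map
      by (auto simp: cells_iff simp del: map_map)
  qed
  have ccomp_src: "csrc L (ccomp L \<psi> \<phi>s) = ?P" using in_L by (simp add: cells_iff)
  have "ccomp L (hd (?\<sigma> ?R)) [fcell F (ccomp K (fcell G \<psi>) (map (fcell G) \<phi>s))] =
      ccomp L (hd (?\<sigma> ?R)) [ccomp L (?FG \<psi>) (map ?FG \<phi>s)]"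
    by (simp add: F.fcell_ccomp[OF compK] comp_def)
  also have "\<dots> = ccomp L (ccomp L (hd (?\<sigma> ?R)) [?FG \<psi>]) (map ?FG \<phi>s)"
    by (rule L.ccomp_assoc_single[OF L.ccomp_single(1)[OF FG_cell[OF c(1)] \<sigma>R] compL])
  also have "ccomp L (hd (?\<sigma> ?R)) [?FG \<psi>] = ccomp L \<psi> (?\<sigma> (csrc L \<psi>))"
    by (rule cell_natural[OF c(1), symmetric])
  also have "csrc L \<psi> = hconcat (map (ctgt L) \<phi>s)"
    using comp by (simp add: composable_def)
  \<comment> \<open>Absorption is used backwards: identity cells are reinserted at empty targets, so
    that every cell of the row has its own component above it.\<close>
  also have "ccomp L \<psi> (?\<sigma> (hconcat (map (ctgt L) \<phi>s))) = ccomp L \<psi> (map (\<lambda>\<phi>. hd (?\<sigma> (ctgt L \<phi>))) \<phi>s)"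
    using absorbs_ccomp[OF iso.fwd.absorbs_tpath[OF L.ctgts_junctions[OF comp]]] comp_s
    by (simp add: s\<phi>)
  \<comment> \<open>Interchange composes each component with the image of its own cell, which makes
    naturality applicable cell by cell.\<close>
  also have "ccomp L (ccomp L \<psi> (map (\<lambda>\<phi>. hd (?\<sigma> (ctgt L \<phi>))) \<phi>s)) (map ?FG \<phi>s) =
      ccomp L \<psi> (map (\<lambda>\<phi>. ccomp L (hd (?\<sigma> (ctgt L \<phi>))) [?FG \<phi>]) \<phi>s)"
    using L.ccomp_assoc_map[OF comp_s _ adj_FG] L.ccomp_single(1)[OF FG_cell s(1)] c(2)
    by simp
  also have "map (\<lambda>\<phi>. ccomp L (hd (?\<sigma> (ctgt L \<phi>))) [?FG \<phi>]) \<phi>s = map (\<lambda>\<phi>. ccomp L \<phi> (?\<sigma> (csrc L \<phi>))) \<phi>s"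
    using cell_natural c(2) by simp
  also have "ccomp L \<psi> \<dots> = ccomp L (ccomp L \<psi> \<phi>s) (concat (map (\<lambda>\<phi>. ?\<sigma> (csrc L \<phi>)) \<phi>s))"
    using L.ccomp_assoc_map[of \<psi> "\<lambda>\<phi>. \<phi>" \<phi>s, OF _ s(4)[OF c(2)] adj_src] comp by simp
  \<comment> \<open>Absorption removes the surplus identity cells that come from empty
    sources.\<close>
  also have "\<dots> = ccomp L (ccomp L \<psi> \<phi>s) (?\<sigma> ?P)"
  proof -
    have "composable L (ccomp L \<psi> \<phi>s) (concat (map ?\<sigma> (map (csrc L) \<phi>s)))"
      using L.composable_assoc(2)[of \<psi> "\<lambda>\<phi>. \<phi>" \<phi>s, OF _ s(4)[OF c(2)] adj_src] comp by (simp add: comp_def)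
    then show ?thesis
      using absorbs_ccomp[OF iso.fwd.absorbs_tpath[OF L.csrcs_junctions[OF comp]]] by (simp add: comp_def)
  qed
  finally show "ccomp L (ccomp L \<psi> \<phi>s) (?\<sigma> ?P) =
      ccomp L (hd (?\<sigma> ?R)) [fcell F (ccomp K (fcell G \<psi>) (map (fcell G) \<phi>s))]" ..
qed

lemma lift_hidc:
  assumes J: "J \<in> Horiz L"
  shows "fcell G (hidc L J) = hidc K (fhoriz G J)"
proof (rule cell_unique[OF L.hidc_in[OF J]])
  show "hidc K (fhoriz G J) \<in> cells K (fpath G (single L J)) (fpath G (single L J))
      (fvert G (vid L (hsrc L J))) (fvert G (vid L (htgt L J)))"
    using K.hidc_in[OF G.horiz_in[OF J]] J
    by (simp add: G.fpath_single G.horiz_src G.horiz_tgt lift_vid L.hsrc_in L.htgt_in)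
  note \<sigma>J = iso.fwd.horiz_comp[OF J]
  have "ccomp L (hidc L J) [thoriz \<sigma> J] = thoriz \<sigma> J"
    using \<sigma>J by (intro L.hidc_ccomp) (auto simp: cells_iff)
  moreover have "ccomp L (thoriz \<sigma> J) [hidc L (fhoriz F (fhoriz G J))] = thoriz \<sigma> J"
    using L.ccomp_hidc[of "thoriz \<sigma> J" _ "[fhoriz F (fhoriz G J)]"] \<sigma>J
    by (auto simp: cells_iff single_def)
  ultimately show "ccomp L (hidc L J) (tpath L \<sigma> (single L J)) =
      ccomp L (hd (tpath L \<sigma> (single L J))) [fcell F (hidc K (fhoriz G J))]"
    by (simp add: tpath_def single_def F.fcell_hidc[OF G.horiz_in[OF J]])
qed

lemma lift_vidc:
  assumes "f \<in> Vert L"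
  shows "fcell G (vidc L f) = vidc K (fvert G f)"
proof -
  define A B where "A = vdom L f" and "B = vcod L f"
  have f: "f \<in> vhom L A B" using assms by (simp add: A_def B_def vhom_iff)
  note ob = vobs[OF f]
  show ?thesis
  proof (rule cell_unique[OF L.vidc_in[OF f]])
    show "vidc K (fvert G f) \<in> cells K (fpath G (A, [])) (fpath G (B, [])) (fvert G f) (fvert G f)"
      using K.vidc_in[OF lift_vert[OF f]] by (simp add: fpath_def)
    have "fcell F (vidc K (fvert G f)) = vidc L (fvert F (fvert G f))"
      using F.fcell_vidc lift_vert[OF f] by (simp add: vhom_iff)
    then show "ccomp L (vidc L f) (tpath L \<sigma> (A, [])) =
        ccomp L (hd (tpath L \<sigma> (B, []))) [fcell F (vidc K (fvert G f))]"
      using L.vidc_vcomp[OF \<sigma>_in f] L.vidc_vcomp[OF F.fvert_in[OF lift_vert[OF f]] \<sigma>_in]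
        ob vert_natural[OF f] by (simp add: tpath_def)
  qed
qed

lemma lift_functor: "avdc_functor L K G"
  by unfold_locales
    (auto simp: G.ob_in G.horiz_in G.horiz_src G.horiz_tgt lift_vert lift_vid lift_vcomp lift_cell
      lift_ccomp lift_hidc lift_vidc)

lemma lift_trans: "avdc_trans L L (functor_comp F G) id_functor \<sigma>"
proof -
  interpret FG: avdc_functor L L "functor_comp F G"
    by (rule avdc_functor_comp[OF lift_functor F.avdc_functor_axioms])
  interpret id: avdc_functor L L id_functor
    by (rule avdc_functor_id[OF L.avdc_axioms])
  show ?thesis
    using iso.fwd.ob_comp iso.fwd.horiz_comp vert_natural cell_natural
    by unfold_locales auto
qed

end

section \<open>Equivalences\<close>

text \<open>An invertible cell comes with some inverses of its vertical boundary. Uniqueness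
  identifies them with one inverse fixed for each object, so that the inverse cells form a
  family.\<close>

lemma (in avdc) vinverse_unique:
  assumes "vinverse K f g" "vinverse K f g'"
  shows "g = g'"
proof -
  have f: "f \<in> vhom K (vdom K f) (vcod K f)" using assms by (simp add: vinverse_def vhom_iff)
  have g: "g \<in> vhom K (vcod K f) (vdom K f)" "g' \<in> vhom K (vcod K f) (vdom K f)"
    using assms by (auto simp: vinverse_def)
  have "g = vcomp K g (vcomp K f g')"
    using assms g vcomp_vid_right by (simp add: vinverse_def)
  also have "\<dots> = vcomp K (vcomp K g f) g'"
    by (rule vcomp_assoc[OF g(2) f g(1)])
  also have "\<dots> = g'"
    using assms g vcomp_vid_left by (simp add: vinverse_def)
  finally show ?thesis .
qed

context
  fixes K :: "('o, 'v, 'h, 'c) avdc_data"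
    and L :: "('p, 'w, 'k, 'd) avdc_data"
    and F :: "('o, 'v, 'h, 'c, 'p, 'w, 'k, 'd) avdc_map"
  assumes KL: "avdc K" "avdc L" and F: "avdc_functor K L F"
begin

interpretation K: avdc K by (rule KL)
interpretation L: avdc L by (rule KL)
interpretation F: avdc_functor K L F by (rule F)

section \<open>Properties of functors with a pseudo-inverse\<close>

text \<open>Conjugation by \<open>\<eta>\<close> recovers a cell or vertical morphism from its image
  under \<open>GF\<close>, hence from its image under \<open>F\<close>. The form of the premise lets
  the lemma be applied to \<open>G\<close> as well, with the inverse of the counit in place of
  \<open>\<eta>\<close>.\<close>

lemma faithful_if_iso_id:
  assumes G: "avdc_functor L K G" and \<eta>: "invertible_trans K K id_functor (functor_comp G F) \<eta>"
  shows "faithful K L F"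
proof -
  interpret G: avdc_functor L K G by fact
  obtain \<eta>' where \<eta>': "avdc_trans K K id_functor (functor_comp G F) \<eta>"
      "avdc_iso_family K K id_functor (functor_comp G F) \<eta> \<eta>'"
    using invertible_transE[OF \<eta>] by metis
  interpret \<eta>: avdc_iso_family K K id_functor "functor_comp G F" \<eta> \<eta>' by (rule \<eta>'(2))
  show ?thesis
    unfolding faithful_def locally_faithful_def
  proof (intro conjI allI impI ballI inj_onI)
    fix P Q f g x y
    assume xy: "x \<in> cells K P Q f g" "y \<in> cells K P Q f g" and eq: "fcell F x = fcell F y"
    have "x = \<eta>.conj P Q (fcell G (fcell F x))" "y = \<eta>.conj P Q (fcell G (fcell F y))"
      using xy \<eta>.conj_natural[OF \<eta>'(1), of x] \<eta>.conj_natural[OF \<eta>'(1), of y] by (auto simp: cells_iff)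
    then show "x = y" using eq by simp
  next
    fix A B x y
    assume xy: "x \<in> vhom K A B" "y \<in> vhom K A B" and eq: "fvert F x = fvert F y"
    have "x = \<eta>.vconj A B (fvert G (fvert F x))" "y = \<eta>.vconj A B (fvert G (fvert F y))"
      using \<eta>.vconj_natural[OF \<eta>'(1) xy(1)] \<eta>.vconj_natural[OF \<eta>'(1) xy(2)] by auto
    then show "x = y" using eq by simp
  qed
qed

lemma full_if_iso_id:
  assumes G: "avdc_functor L K G" "faithful L K G"
    and \<eta>: "invertible_trans K K id_functor (functor_comp G F) \<eta>"
  shows "full K L F"
proof -
  interpret G: avdc_functor L K G by fact
  obtain \<eta>' where \<eta>': "avdc_trans K K id_functor (functor_comp G F) \<eta>"
      "avdc_iso_family K K id_functor (functor_comp G F) \<eta> \<eta>'"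
    using invertible_transE[OF \<eta>] by metis
  interpret \<eta>: avdc_iso_family K K id_functor "functor_comp G F" \<eta> \<eta>' by (rule \<eta>'(2))
  \<comment> \<open>This brings the vertical boundary of the conjugate of \<open>G \<chi>\<close>
    back to \<open>f\<close> and \<open>g\<close>.\<close>
  have vert: "\<eta>.vconj A B (fvert G (fvert F f)) = f" if "f \<in> vhom K A B" for f A B
    using \<eta>.vconj_natural[OF \<eta>'(1) that] by simp
  have cell: "\<chi> \<in> fcell F ` cells K P Q f g"
    if b: "boundary K P Q f g" and \<chi>: "\<chi> \<in> cells L (fpath F P) (fpath F Q) (fvert F f) (fvert F g)"
    for P Q f g \<chi>
  proof -
    define A B C D where "A = vdom K f" and "B = vdom K g" and "C = vcod K f" and "D = vcod K g"
    have fg: "f \<in> vhom K A C" "g \<in> vhom K B D"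
      and p: "is_hpath K P A B" "is_hpath K Q C D" "length (snd Q) \<le> 1"
      using b by (auto simp: boundary_def vhom_iff A_def B_def C_def D_def)
    have G\<chi>: "fcell G \<chi> \<in> cells K (fpath (functor_comp G F) P) (fpath (functor_comp G F) Q)
        (fvert G (fvert F f)) (fvert G (fvert F g))"
      using G.fcell_in[OF \<chi>] by (simp add: fpath_functor_comp)
    define \<phi> where "\<phi> = \<eta>.conj P Q (fcell G \<chi>)"
    have \<phi>: "\<phi> \<in> cells K P Q f g"
      using \<eta>.conj_in[OF G\<chi> p] vert[OF fg(1)] vert[OF fg(2)] by (simp add: \<phi>_def)
    have GF\<phi>: "fcell G (fcell F \<phi>) \<in> cells K (fpath (functor_comp G F) P) (fpath (functor_comp G F) Q)
        (fvert G (fvert F f)) (fvert G (fvert F g))"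
      using G.fcell_in[OF F.fcell_in[OF \<phi>]] by (simp add: fpath_functor_comp)
    \<comment> \<open>By naturality, conjugating \<open>G F \<phi>\<close> returns
      \<open>\<phi>\<close>, which was defined as the conjugate of \<open>G \<chi>\<close>.\<close>
    have "\<eta>.conj P Q (fcell G (fcell F \<phi>)) = \<eta>.conj P Q (fcell G \<chi>)"
      using \<eta>.conj_natural[OF \<eta>'(1), of \<phi>] \<phi> by (simp add: cells_iff flip: \<phi>_def)
    then have "fcell G (fcell F \<phi>) = fcell G \<chi>"
      by (rule \<eta>.conj_inj[OF GF\<phi> G\<chi> p])
    then have "fcell F \<phi> = \<chi>"
      by (rule faithful_cells[OF KL(2) G(2) F.fcell_in[OF \<phi>] \<chi>])
    then show ?thesis using \<phi> by blast
  qed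
  have vhom: "e \<in> fvert F ` vhom K A B"
    if ob: "A \<in> Ob K" "B \<in> Ob K" and e: "e \<in> vhom L (fob F A) (fob F B)" for A B e
  proof -
    have Ge: "fvert G e \<in> vhom K (fob (functor_comp G F) A) (fob (functor_comp G F) B)"
      using G.fvert_in[OF e] by simp
    define f where "f = \<eta>.vconj A B (fvert G e)"
    have f: "f \<in> vhom K A B"
      using \<eta>.vconj_in[OF Ge ob] by (simp add: f_def)
    have GFf: "fvert G (fvert F f) \<in> vhom K (fob (functor_comp G F) A) (fob (functor_comp G F) B)"
      using G.fvert_in[OF F.fvert_in[OF f]] by simp
    have "fvert G (fvert F f) = fvert G e"
      using \<eta>.vconj_inj[OF GFf Ge ob] vert[OF f] by (simp flip: f_def)
    then have "fvert F f = e"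
      by (rule faithful_vhom[OF KL(2) G(2) F.fvert_in[OF f] e])
    then show ?thesis using f by blast
  qed
  show ?thesis
    unfolding full_def locally_full_def
    using cell vhom F.fcell_in F.fvert_in by (fastforce intro: set_eqI)
qed

text \<open>The pseudo-inverse itself makes the simultaneous choice of objects and horizontal
  morphisms, and the components of \<open>\<epsilon>\<close> are the required isomorphisms.\<close>

lemma essentially_surjective_if_iso_id:
  assumes G: "avdc_functor L K G" and \<epsilon>: "invertible_trans L L (functor_comp F G) id_functor \<epsilon>"
  shows "essentially_surjective K L F"
proof -
  interpret G: avdc_functor L K G by fact
  obtain \<epsilon>' where \<epsilon>': "avdc_iso_family L L (functor_comp F G) id_functor \<epsilon> \<epsilon>'"
    using invertible_transE[OF \<epsilon>] by metis
  interpret \<epsilon>: avdc_iso_family L L "functor_comp F G" id_functor \<epsilon> \<epsilon>' by (rule \<epsilon>')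
  interpret \<epsilon>': avdc_iso_family L L id_functor "functor_comp F G" \<epsilon>' \<epsilon> by (rule \<epsilon>.swap)
  have inv: "vinverse L (tob \<epsilon> A) (tob \<epsilon>' A)" if A: "A \<in> Ob L" for A
    using \<epsilon>.left_inv_comp(1)[OF A] \<epsilon>'.left_inv_comp(1)[OF A] \<epsilon>.fwd.ob_comp[OF A] \<epsilon>.bwd.ob_comp[OF A]
    by (simp add: vinverse_def vhom_iff)
  have "invertible_cell L (fhoriz F (fhoriz G J)) J (thoriz \<epsilon> J)" if J: "J \<in> Horiz L" for J
  proof -
    note c = \<epsilon>.fwd.horiz_comp[OF J]
    have "thoriz \<epsilon>' J \<in> cells L (single L J) (single L (fhoriz F (fhoriz G J))) (tob \<epsilon>' (hsrc L J)) (tob \<epsilon>' (htgt L J))"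
      using \<epsilon>.bwd.horiz_comp[OF J] by simp
    then show ?thesis
      using c \<epsilon>.left_inv_comp(2)[OF J] \<epsilon>'.left_inv_comp(2)[OF J] inv[OF L.hsrc_in[OF J]] inv[OF L.htgt_in[OF J]]
      unfolding invertible_cell_def cells_iff[of "thoriz \<epsilon> J"] by auto
  qed
  then show ?thesis
    unfolding essentially_surjective_def
    using inv G.fob_in G.fhoriz_in G.fhoriz_hsrc G.fhoriz_htgt \<epsilon>.fwd.ob_comp \<epsilon>.fwd.horiz_comp
    by (intro exI[of _ "fob G"] exI[of _ "tob \<epsilon>"] exI[of _ "fhoriz G"] exI[of _ "thoriz \<epsilon>"])
      (auto simp: cells_iff)
qed

section \<open>Existence of the lifted action\<close>

text \<open>The choices are made in order of dependence: objects and horizontal morphisms with their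
  isomorphisms, then preimages of conjugated vertical morphisms, and last the preimages of
  conjugated cells.\<close>

lemma ex_avdc_lift:
  assumes full: "full K L F" and faithful: "faithful K L F" and es: "essentially_surjective K L F"
  obtains G \<sigma> \<tau> where "avdc_lift K L F G \<sigma> \<tau>"
proof -
  obtain ob' s\<^sub>o hor' s\<^sub>h where
    ob': "\<And>A. A \<in> Ob L \<Longrightarrow> ob' A \<in> Ob K \<and> s\<^sub>o A \<in> vhom L (fob F (ob' A)) A \<and> (\<exists>g. vinverse L (s\<^sub>o A) g)"
    and hor': "\<And>J. J \<in> Horiz L \<Longrightarrow> hor' J \<in> Horiz K \<and>
           hsrc K (hor' J) = ob' (hsrc L J) \<and> htgt K (hor' J) = ob' (htgt L J) \<and>
           invertible_cell L (fhoriz F (hor' J)) J (s\<^sub>h J) \<and>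
           cvsrc L (s\<^sub>h J) = s\<^sub>o (hsrc L J) \<and> cvtgt L (s\<^sub>h J) = s\<^sub>o (htgt L J)"
    using es unfolding essentially_surjective_def by blast
  obtain t\<^sub>o where t\<^sub>o: "\<And>A. A \<in> Ob L \<Longrightarrow> vinverse L (s\<^sub>o A) (t\<^sub>o A)"
    using ob' by metis
  have "\<exists>\<psi>. \<psi> \<in> cells L (single L J) (single L (fhoriz F (hor' J))) (t\<^sub>o (hsrc L J)) (t\<^sub>o (htgt L J)) \<and>
      ccomp L \<psi> [s\<^sub>h J] = hidc L (fhoriz F (hor' J)) \<and> ccomp L (s\<^sub>h J) [\<psi>] = hidc L J"
    if J: "J \<in> Horiz L" for J
  proof -
    obtain f g \<psi> where "vinverse L (s\<^sub>o (hsrc L J)) f" "vinverse L (s\<^sub>o (htgt L J)) g"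
      and \<psi>: "\<psi> \<in> cells L (single L J) (single L (fhoriz F (hor' J))) f g"
      "ccomp L \<psi> [s\<^sub>h J] = hidc L (fhoriz F (hor' J))" "ccomp L (s\<^sub>h J) [\<psi>] = hidc L J"
      using hor'[OF J] unfolding invertible_cell_def by auto
    then have "f = t\<^sub>o (hsrc L J)" "g = t\<^sub>o (htgt L J)"
      using L.vinverse_unique t\<^sub>o L.hsrc_in[OF J] L.htgt_in[OF J] by blast+
    then show ?thesis using \<psi> by blast
  qed
  then obtain t\<^sub>h where t\<^sub>h: "\<And>J. J \<in> Horiz L \<Longrightarrow>
      t\<^sub>h J \<in> cells L (single L J) (single L (fhoriz F (hor' J))) (t\<^sub>o (hsrc L J)) (t\<^sub>o (htgt L J)) \<and>
      ccomp L (t\<^sub>h J) [s\<^sub>h J] = hidc L (fhoriz F (hor' J)) \<and> ccomp L (s\<^sub>h J) [t\<^sub>h J] = hidc L J"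
    by metis
  define \<sigma> where "\<sigma> = \<lparr>tob = s\<^sub>o, thoriz = s\<^sub>h\<rparr>"
  define \<tau> where "\<tau> = \<lparr>tob = t\<^sub>o, thoriz = t\<^sub>h\<rparr>"
  \<comment> \<open>Stated for every \<open>G\<close> with the chosen values on objects and
    horizontal morphisms, because it serves both the provisional map below and the final
    one.\<close>
  have iso: "avdc_iso_family L L (functor_comp F G) id_functor \<sigma> \<tau>"
    if "fob G = ob'" "fhoriz G = hor'" for G
  proof -
    have "avdc_graph_map L L (functor_comp F G)"
      by unfold_locales (auto simp: that ob' hor' F.fob_in F.fhoriz_in F.fhoriz_hsrc F.fhoriz_htgt)
    moreover have "avdc_graph_map L L id_functor"
      by unfold_locales auto
    moreover have "tob \<sigma> A \<in> vhom L (fob F (ob' A)) A" "tob \<tau> A \<in> vhom L A (fob F (ob' A))"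
      "vcomp L (tob \<tau> A) (tob \<sigma> A) = vid L (fob F (ob' A))" "vcomp L (tob \<sigma> A) (tob \<tau> A) = vid L A"
      if "A \<in> Ob L" for A
      using ob'[OF that] t\<^sub>o[OF that] by (auto simp: \<sigma>_def \<tau>_def vinverse_def vhom_iff)
    moreover have "thoriz \<sigma> J \<in> cells L (single L (fhoriz F (hor' J))) (single L J)
        (tob \<sigma> (hsrc L J)) (tob \<sigma> (htgt L J))" if "J \<in> Horiz L" for J
      using hor'[OF that] by (auto simp: \<sigma>_def invertible_cell_def cells_iff)
    moreover have "thoriz \<tau> J \<in> cells L (single L J) (single L (fhoriz F (hor' J)))
        (tob \<tau> (hsrc L J)) (tob \<tau> (htgt L J))"
      "ccomp L (thoriz \<tau> J) [thoriz \<sigma> J] = hidc L (fhoriz F (hor' J))"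
      "ccomp L (thoriz \<sigma> J) [thoriz \<tau> J] = hidc L J" if "J \<in> Horiz L" for J
      using t\<^sub>h[OF that] by (auto simp: \<sigma>_def \<tau>_def)
    ultimately show ?thesis
      using KL(2) that
      by (intro avdc_iso_family.intro avdc_family.intro avdc_family_axioms.intro avdc_iso_family_axioms.intro)
        (auto simp: trans_eq_def trans_comp_def id_trans_def)
  qed
  \<comment> \<open>A provisional map that gives access to conjugation before vertical morphisms and
    cells are lifted. Its undefined fields are harmless: conjugation is built from
    \<open>\<sigma>\<close> and \<open>\<tau>\<close> alone, so the final map has the same
    one.\<close>
  define G\<^sub>0 :: "('p, 'w, 'k, 'd, 'o, 'v, 'h, 'c) avdc_map" where
    "G\<^sub>0 = \<lparr>fob = ob', fvert = undefined, fhoriz = hor', fcell = undefined\<rparr>"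
  interpret iso: avdc_iso_family L L "functor_comp F G\<^sub>0" id_functor \<sigma> \<tau>
    by (rule iso) (simp_all add: G\<^sub>0_def)
  have graph: "avdc_graph_map L K G" if "fob G = ob'" "fhoriz G = hor'" for G
    by unfold_locales (auto simp: that ob' hor')
  interpret G\<^sub>0: avdc_graph_map L K G\<^sub>0
    by (rule graph) (simp_all add: G\<^sub>0_def)
  have "\<exists>x. x \<in> vhom K (ob' (vdom L f)) (ob' (vcod L f)) \<and> fvert F x = iso.vconj (vdom L f) (vcod L f) f"
    if f: "f \<in> Vert L" for f
  proof -
    have ob: "vdom L f \<in> Ob L" "vcod L f \<in> Ob L" using f L.vdom_in L.vcod_in by auto
    have "iso.vconj (vdom L f) (vcod L f) f \<in> vhom L (fob F (ob' (vdom L f))) (fob F (ob' (vcod L f)))"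
      using iso.vconj_in[of f "vdom L f" "vcod L f"] f ob by (simp add: vhom_iff G\<^sub>0_def)
    then show ?thesis using full_vhom[OF full] ob' ob by metis
  qed
  then obtain gv where gv: "\<And>f. f \<in> Vert L \<Longrightarrow>
      gv f \<in> vhom K (ob' (vdom L f)) (ob' (vcod L f)) \<and> fvert F (gv f) = iso.vconj (vdom L f) (vcod L f) f"
    by metis
  \<comment> \<open>Cells are lifted only now because the boundary of a lifted cell consists of the
    vertical morphisms just chosen by \<open>gv\<close>.\<close>
  have "\<exists>x. x \<in> cells K (fpath G\<^sub>0 (csrc L \<phi>)) (fpath G\<^sub>0 (ctgt L \<phi>)) (gv (cvsrc L \<phi>)) (gv (cvtgt L \<phi>)) \<and>
      fcell F x = iso.conj (csrc L \<phi>) (ctgt L \<phi>) \<phi>" if \<phi>: "\<phi> \<in> Cell L" for \<phi>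
  proof -
    note p = L.csrc_path[OF \<phi>] L.ctgt_path[OF \<phi>] L.ctgt_length[OF \<phi>]
    note v = gv[OF L.cvsrc_in[OF \<phi>]] gv[OF L.cvtgt_in[OF \<phi>]]
    have b: "boundary K (fpath G\<^sub>0 (csrc L \<phi>)) (fpath G\<^sub>0 (ctgt L \<phi>)) (gv (cvsrc L \<phi>)) (gv (cvtgt L \<phi>))"
      using v p(3) G\<^sub>0.hpath_map[OF p(1)] G\<^sub>0.hpath_map[OF p(2)]
      by (simp add: boundary_def vhom_iff G\<^sub>0_def fpath_def)
    have "iso.conj (csrc L \<phi>) (ctgt L \<phi>) \<phi> \<in> cells L (fpath F (fpath G\<^sub>0 (csrc L \<phi>))) (fpath F (fpath G\<^sub>0 (ctgt L \<phi>)))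
        (fvert F (gv (cvsrc L \<phi>))) (fvert F (gv (cvtgt L \<phi>)))"
      using iso.conj_in[OF _ p, of \<phi> "cvsrc L \<phi>" "cvtgt L \<phi>"] v \<phi> by (simp add: fpath_functor_comp cells_iff)
    then show ?thesis using full_cells[OF full b] by metis
  qed
  then obtain gc where gc: "\<And>\<phi>. \<phi> \<in> Cell L \<Longrightarrow>
      gc \<phi> \<in> cells K (fpath G\<^sub>0 (csrc L \<phi>)) (fpath G\<^sub>0 (ctgt L \<phi>)) (gv (cvsrc L \<phi>)) (gv (cvtgt L \<phi>)) \<and>
      fcell F (gc \<phi>) = iso.conj (csrc L \<phi>) (ctgt L \<phi>) \<phi>" by metis
  define G where "G = \<lparr>fob = ob', fvert = gv, fhoriz = hor', fcell = gc\<rparr>"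
  have G0: "fpath G\<^sub>0 P = fpath G P" for P by (simp add: fpath_def G_def G\<^sub>0_def)
  have "avdc_lift K L F G \<sigma> \<tau>"
  proof (intro avdc_lift.intro avdc_lift_axioms.intro KL F faithful)
    show "avdc_iso_family L L (functor_comp F G) id_functor \<sigma> \<tau>" by (rule iso) (simp_all add: G_def)
    show "avdc_graph_map L K G" by (rule graph) (simp_all add: G_def)
  next
    fix f A B assume "f \<in> vhom L A B"
    then have f: "f \<in> Vert L" "vdom L f = A" "vcod L f = B" by (auto simp: vhom_iff)
    show "fvert G f \<in> vhom K (fob G A) (fob G B)" "fvert F (fvert G f) = iso.vconj A B f"
      using gv[OF f(1)] f(2,3) by (auto simp: G_def)
  next
    fix \<phi> P Q f g assume "\<phi> \<in> cells L P Q f g"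
    then show "fcell G \<phi> \<in> cells K (fpath G P) (fpath G Q) (fvert G f) (fvert G g)"
      using gc[of \<phi>, unfolded G0] by (auto simp: cells_iff[of _ L] G_def)
  next
    fix \<phi> assume "\<phi> \<in> Cell L"
    then show "fcell F (fcell G \<phi>) = iso.conj (csrc L \<phi>) (ctgt L \<phi>) \<phi>"
      using gc by (simp add: G_def)
  qed
  then show thesis by (rule that)
qed

end

section \<open>Equivalences as full, faithful and essentially surjective functors\<close>

theorem proposition3p8:
  fixes K :: "('o, 'v, 'h, 'c) avdc_data"
    and L :: "('p, 'w, 'k, 'd) avdc_data"
    and F :: "('o, 'v, 'h, 'c, 'p, 'w, 'k, 'd) avdc_map"
  assumes "avdc K" and "avdc L" and "avdc_functor K L F"
  shows "avdc_equivalence K L F \<longleftrightarrow>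
    full K L F \<and> faithful K L F \<and> essentially_surjective K L F"
proof
  assume "avdc_equivalence K L F"
  then obtain G \<eta> \<epsilon> where G: "avdc_functor L K G"
    and \<eta>: "invertible_trans K K id_functor (functor_comp G F) \<eta>"
    and \<epsilon>: "invertible_trans L L (functor_comp F G) id_functor \<epsilon>"
    unfolding avdc_equivalence_def by blast
  obtain \<epsilon>' where "invertible_trans L L id_functor (functor_comp F G) \<epsilon>'"
    using invertible_trans_sym[OF \<epsilon>] .
  \<comment> \<open>The roles of \<open>F\<close> and \<open>G\<close> are exchanged: the inverse of
    the counit is an isomorphism from the identity to \<open>FG\<close>.\<close>
  then have "faithful L K G" by (rule faithful_if_iso_id[OF assms(2,1) G assms(3)])
  then show "full K L F \<and> faithful K L F \<and> essentially_surjective K L F"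
    using full_if_iso_id[OF assms G _ \<eta>] faithful_if_iso_id[OF assms G \<eta>]
      essentially_surjective_if_iso_id[OF assms G \<epsilon>] by blast
next
  assume F: "full K L F \<and> faithful K L F \<and> essentially_surjective K L F"
  then obtain G \<sigma> \<tau> where "avdc_lift K L F G \<sigma> \<tau>"
    using ex_avdc_lift[OF assms] by blast
  then interpret avdc_lift K L F G \<sigma> \<tau> .
  have \<sigma>: "invertible_trans L L (functor_comp F G) id_functor \<sigma>"
    by (rule iso.invertible[OF lift_trans])
  \<comment> \<open>Whiskering gives an isomorphism from \<open>FGF\<close> to \<open>F\<close>;
    writing the codomain as \<open>F\<close> after the identity exhibits it as one that can be
    reflected along \<open>F\<close>.\<close>
  have "invertible_trans K L (functor_comp F (functor_comp G F)) (functor_comp F id_functor) (whisker \<sigma> F)"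
    using invertible_whisker[OF assms(3) \<sigma>] by (simp add: functor_comp_assoc)
  then obtain \<eta>' where "invertible_trans K K (functor_comp G F) id_functor \<eta>'"
    using invertible_reflect[OF assms(3) _ _ avdc_functor_comp[OF assms(3) lift_functor] avdc_functor_id[OF assms(1)]]
      F by blast
  then obtain \<eta> where "invertible_trans K K id_functor (functor_comp G F) \<eta>"
    using invertible_trans_sym by blast
  then show "avdc_equivalence K L F"
    unfolding avdc_equivalence_def using assms(3) lift_functor \<sigma> by blast
qed

end
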